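(* Let $\theta\in\mathbb R\setminus\mathbb Q$. Then the Hochschild cohomology of $\mathcal A_\theta^{alg}\rtimes\mathbb Z_2$ with coefficients in its linear dual satisfies $H^0(\mathcal A_\theta^{alg}\rtimes\mathbb Z_2,(\mathcal A_\theta^{alg}\rtimes\mathbb Z_2)^* )\cong\mathbb C^5$, $H^1(\mathcal A_\theta^{alg}\rtimes\mathbb Z_2,(\mathcal A_\theta^{alg}\rtimes\mathbb Z_2)^* )=0$, and $H^2(\mathcal A_\theta^{alg}\rtimes\mathbb Z_2,(\mathcal A_\theta^{alg}\rtimes\mathbb Z_2)^* )\cong\mathbb C$.
   Context: Let $\lambda=e^{2\pi i\theta}$. The algebraic noncommutative torus $\mathcal A_\theta^{alg}$ is the complex algebra of finite linear combinations $\sum a_{n,m}U_1^nU_2^m$ ($(n,m)\in\mathbb Z^2$) generated by invertible elements $U_1,U_2$ subject to $U_2U_1=\lambda U_1U_2$. The group $\mathbb Z_2=\{1,-1\}$ acts on $\mathcal A_\theta^{alg}$ by the automorphism $\sigma$ with $\sigma(U_j)=U_j^{-1}$, $j=1,2$. The crossed product $\mathcal A_\theta^{alg}\rtimes\mathbb Z_2$ is the algebra generated by $\mathcal A_\theta^{alg}$ and an element $t$ with $t^2=1$ and $tat=\sigma(a)$ for $a\in\mathcal A_\theta^{alg}$. For an algebra $B$, $B^*$ denotes its algebraic linear dual with the standard $B$-bimodule structure, and $H^\bullet(B,M)$ denotes Hochschild cohomology with coefficients in the bimodule $M$. *)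

theory Defs
  imports Complex_Main "HOL-Library.Poly_Mapping"
begin

text \<open>Elements of the algebraic crossed product A_theta^alg x| Z_2, written as finite linear
combinations of the basis elements U1^n U2^m t^e.  A basis index (n,m,e) with e = False stands
for U1^n U2^m and e = True stands for U1^n U2^m t.\<close>

type_synonym idx = "int \<times> int \<times> bool"
type_synonym ncz = "idx \<Rightarrow>\<^sub>0 complex"

definition lam :: "real \<Rightarrow> complex" where
  "lam \<theta> = cis (2 * pi * \<theta>)"

text \<open>(U1^a U2^b t^e)(U1^c U2^d t^f) = lam^(b c') U1^(a+c') U2^(b+d') t^(e+f),
  where (c',d') = (c,d) if e = 0 and (c',d') = (-c,-d) if e = 1.\<close>
definition bidx :: "idx \<Rightarrow> idx \<Rightarrow> idx" where
  "bidx x y = (case x of (a,b,e) \<Rightarrow> case y of (c,d,f) \<Rightarrow>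
     (let c' = (if e then -c else c); d' = (if e then -d else d) in (a + c', b + d', e \<noteq> f)))"

definition bcoef :: "real \<Rightarrow> idx \<Rightarrow> idx \<Rightarrow> complex" where
  "bcoef \<theta> x y = (case x of (a,b,e) \<Rightarrow> case y of (c,d,f) \<Rightarrow>
     lam \<theta> powi (b * (if e then -c else c)))"

definition bmul :: "real \<Rightarrow> ncz \<Rightarrow> ncz \<Rightarrow> ncz" where
  "bmul \<theta> f g = (\<Sum>x\<in>Poly_Mapping.keys f. \<Sum>y\<in>Poly_Mapping.keys g.
      Poly_Mapping.single (bidx x y) (Poly_Mapping.lookup f x * Poly_Mapping.lookup g y * bcoef \<theta> x y))"

definition bscale :: "complex \<Rightarrow> ncz \<Rightarrow> ncz" where
  "bscale c f = Poly_Mapping.map (\<lambda>v. c * v) f"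

text \<open>Hochschild n-cochains with values in the linear dual B^*: maps phi from n-tuples (lists of
length n) of algebra elements to linear functionals on B, linear in each argument.
Value at lists of other length is 0 by convention.\<close>

definition cochains :: "nat \<Rightarrow> (ncz list \<Rightarrow> ncz \<Rightarrow> complex) set" where
  "cochains n = {\<phi>.
     (\<forall>xs. length xs \<noteq> n \<longrightarrow> \<phi> xs = (\<lambda>_. 0)) \<and>
     (\<forall>xs. length xs = n \<longrightarrow>
        (\<forall>a b. \<phi> xs (a + b) = \<phi> xs a + \<phi> xs b) \<and>
        (\<forall>c a. \<phi> xs (bscale c a) = c * \<phi> xs a) \<and>
        (\<forall>i<n. \<forall>a b. \<phi> (xs[i := a + b]) = (\<lambda>y. \<phi> (xs[i := a]) y + \<phi> (xs[i := b]) y)) \<and>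
        (\<forall>i<n. \<forall>c a. \<phi> (xs[i := bscale c a]) = (\<lambda>y. c * \<phi> (xs[i := a]) y)))}"

text \<open>Hochschild coboundary with coefficients in the dual bimodule, where
(a . xi)(b) = xi(b a) and (xi . a)(b) = xi(a b):
(d phi)(a_1,...,a_(n+1)) = a_1 . phi(a_2,...,a_(n+1))
   + sum_(i=1..n) (-1)^i phi(a_1,...,a_i a_(i+1),...,a_(n+1))
   + (-1)^(n+1) phi(a_1,...,a_n) . a_(n+1).\<close>

definition hcobound :: "real \<Rightarrow> nat \<Rightarrow> (ncz list \<Rightarrow> ncz \<Rightarrow> complex) \<Rightarrow> (ncz list \<Rightarrow> ncz \<Rightarrow> complex)" where
  "hcobound \<theta> n \<phi> = (\<lambda>ys b. if length ys = n + 1 then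
       \<phi> (tl ys) (bmul \<theta> b (ys ! 0))
     + (\<Sum>i=1..n. (-1) ^ i *
          \<phi> (take (i - 1) ys @ [bmul \<theta> (ys ! (i - 1)) (ys ! i)] @ drop (i + 1) ys) b)
     + (-1) ^ (n + 1) * \<phi> (butlast ys) (bmul \<theta> (last ys) b)
     else 0)"

definition cocycles :: "real \<Rightarrow> nat \<Rightarrow> (ncz list \<Rightarrow> ncz \<Rightarrow> complex) set" where
  "cocycles \<theta> n = {\<phi> \<in> cochains n. hcobound \<theta> n \<phi> = (\<lambda>_ _. 0)}"

definition coboundaries :: "real \<Rightarrow> nat \<Rightarrow> (ncz list \<Rightarrow> ncz \<Rightarrow> complex) set" where
  "coboundaries \<theta> n = (if n = 0 then {\<lambda>_ _. 0} else hcobound \<theta> (n - 1) ` cochains (n - 1))"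

definition lincomb :: "(nat \<Rightarrow> complex) \<Rightarrow> (ncz list \<Rightarrow> ncz \<Rightarrow> complex) list \<Rightarrow> (ncz list \<Rightarrow> ncz \<Rightarrow> complex)" where
  "lincomb c \<phi>s = (\<lambda>ys b. \<Sum>i<length \<phi>s. c i * (\<phi>s ! i) ys b)"

definition hh_dim :: "real \<Rightarrow> nat \<Rightarrow> nat \<Rightarrow> bool" where
  "hh_dim \<theta> n d \<longleftrightarrow> (\<exists>\<phi>s. length \<phi>s = d \<and> set \<phi>s \<subseteq> cocycles \<theta> n \<and>
     (\<forall>c. lincomb c \<phi>s \<in> coboundaries \<theta> n \<longrightarrow> (\<forall>i<d. c i = 0)) \<and>
     (\<forall>z\<in>cocycles \<theta> n. \<exists>c. (\<lambda>ys b. z ys b - lincomb c \<phi>s ys b) \<in> coboundaries \<theta> n))"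

end

theory Submission
  imports Defs "HOL-Library.Function_Algebras" "HOL-Algebra.Group"
begin

text \<open>Write u_g for the basis element of index g, where g ranges over the group Z^2 x| Z_2. Since
the u_g are invertible and multiply up to scalars, the substitution
phi(u_g, u_h)(u_k) = coefficient(u_g u_h u_k) * f(g, h)(g h k) identifies Hochschild cochains with
group cochains valued in the functions on the group, on which u_g acts by conjugation. Over Z^2 this
module splits into characters, all non-trivial except at the identity because theta is irrational,
and the functions on the t-coset, on which U1 and U2 act, up to a phase, as the translations by 2.
This gives the five invariants and solves the equations for 1-cocycles up to their values at the
identity, which vanish because t inverts U1 and U2.

A 2-cocycle f is trivialised by a homomorphic section of the group extension it defines. Averaging
over the involution yields lifts T, V1, V2 with T^2 = 1 and T V_i T = V_i^-1, and the commutator of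
V2 and V1 can be reduced to a multiple c of the trace. Hence the section V1^a V2^b T^e shows
that f is cohomologous to c times the explicit cocycle given by the exponent of lam in the
multiplication. That cocycle is not a coboundary since its antisymmetrisation at (U2, U1), evaluated
at the identity, is non-zero.\<close>

section \<open>Multilinear functions on the crossed product\<close>

definition lin :: "(ncz \<Rightarrow> complex) \<Rightarrow> bool" where
  "lin L \<longleftrightarrow> (\<forall>a b. L (a + b) = L a + L b) \<and> (\<forall>c a. L (bscale c a) = c * L a)"

abbreviation ubas :: "idx \<Rightarrow> ncz" where
  "ubas k \<equiv> Poly_Mapping.single k 1"

lemma lookup_bscale [simp]: "Poly_Mapping.lookup (bscale c f) k = c * Poly_Mapping.lookup f k"
  unfolding bscale_def by (simp add: Poly_Mapping.map.rep_eq when_def)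

lemma bscale_single: "bscale c (Poly_Mapping.single k v) = Poly_Mapping.single k (c * v)"
  by (rule poly_mapping_eqI) (simp add: lookup_single when_def)

lemma bscale_simps [simp]: "bscale c 0 = 0" "bscale c (a + b) = bscale c a + bscale c b"
  by (rule poly_mapping_eqI, simp add: lookup_add algebra_simps)+

lemma bscale_sum: "bscale c (sum f A) = (\<Sum>x\<in>A. bscale c (f x))"
  by (induction A rule: infinite_finite_induct) simp_all

lemma keys_bscale: "Poly_Mapping.keys (bscale c f) \<subseteq> Poly_Mapping.keys f"
  by (auto simp: in_keys_iff)

lemma linD:
  assumes "lin L"
  shows "L (a + b) = L a + L b" "L (bscale c a) = c * L a" "L 0 = 0"
proof -
  show 1: "L (a + b) = L a + L b" and "L (bscale c a) = c * L a" for a b c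
    using assms by (auto simp: lin_def)
  show "L 0 = 0" using 1[of 0 0] by simp
qed

lemma lin_sum: "lin L \<Longrightarrow> L (sum f A) = (\<Sum>x\<in>A. L (f x))"
  by (induction A rule: infinite_finite_induct) (simp_all add: linD)

lemma lin_comb:
  "lin (\<lambda>_. 0)"
  "lin L \<Longrightarrow> lin K \<Longrightarrow> lin (\<lambda>b. L b + K b)"
  "lin L \<Longrightarrow> lin K \<Longrightarrow> lin (\<lambda>b. L b - K b)"
  "lin L \<Longrightarrow> lin (\<lambda>b. c * L b)"
  by (simp_all add: lin_def algebra_simps)

lemma lin_eq_zero:
  assumes L: "lin L" and z: "\<And>k. L (ubas k) = 0"
  shows "L b = 0"
proof -
  have "b = (\<Sum>k\<in>Poly_Mapping.keys b. bscale (Poly_Mapping.lookup b k) (ubas k))"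
    by (rule poly_mapping_eqI)
       (simp add: bscale_single lookup_sum lookup_single when_def sum.delta' in_keys_iff)
  also have "L \<dots> = 0" using z by (simp add: lin_sum[OF L] linD[OF L])
  finally show ?thesis .
qed

section \<open>Linear extension from the basis\<close>

definition linext :: "(idx \<Rightarrow> complex) \<Rightarrow> ncz \<Rightarrow> complex" where
  "linext m b = (\<Sum>k\<in>Poly_Mapping.keys b. Poly_Mapping.lookup b k * m k)"

text \<open>The sum in \<open>linext\<close> runs over the support of its argument, so additivity is
  not visible. Over a common finite range containing all supports involved, the summands are linear
  in the argument. \<open>bmul_superset\<close> serves the same purpose for the product.\<close>

lemma linext_superset:
  "finite K \<Longrightarrow> Poly_Mapping.keys b \<subseteq> K \<Longrightarrow> linext m b = (\<Sum>k\<in>K. Poly_Mapping.lookup b k * m k)"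
  unfolding linext_def by (rule sum.mono_neutral_left) (auto simp: in_keys_iff)

lemma lin_linext [simp]: "lin (linext m)"
  unfolding lin_def
proof (intro conjI allI)
  fix a b :: ncz and c
  let ?K = "Poly_Mapping.keys a \<union> Poly_Mapping.keys b"
  have "linext m (a + b) = (\<Sum>k\<in>?K. Poly_Mapping.lookup (a + b) k * m k)"
    by (rule linext_superset) (auto simp: Poly_Mapping.keys_add)
  also have "\<dots> = (\<Sum>k\<in>?K. Poly_Mapping.lookup a k * m k) + (\<Sum>k\<in>?K. Poly_Mapping.lookup b k * m k)"
    by (simp add: lookup_add algebra_simps sum.distrib)
  also have "\<dots> = linext m a + linext m b"
    by (subst (1 2) linext_superset[of ?K]) auto
  finally show "linext m (a + b) = linext m a + linext m b" .
  have "linext m (bscale c a) = (\<Sum>k\<in>Poly_Mapping.keys a. Poly_Mapping.lookup (bscale c a) k * m k)"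
    by (rule linext_superset) (use keys_bscale in auto)
  also have "\<dots> = c * linext m a" by (simp add: linext_def sum_distrib_left mult.assoc)
  finally show "linext m (bscale c a) = c * linext m a" .
qed

lemma linext_ubas [simp]: "linext m (ubas k) = m k"
  by (simp add: linext_def)

lemma lin_linext_arg:
  assumes "\<And>k. lin (F k)"
  shows "lin (\<lambda>b. linext (\<lambda>k. F k b) x)"
  using assms unfolding lin_def linext_def
  by (simp add: sum.distrib sum_distrib_left algebra_simps)

section \<open>Bilinearity of the product\<close>

lemma bmul_superset:
  assumes "finite X" "finite Y" "Poly_Mapping.keys f \<subseteq> X" "Poly_Mapping.keys g \<subseteq> Y"
  shows "bmul \<theta> f g = (\<Sum>x\<in>X. \<Sum>y\<in>Y.
      Poly_Mapping.single (bidx x y) (Poly_Mapping.lookup f x * Poly_Mapping.lookup g y * bcoef \<theta> x y))"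
    (is "_ = (\<Sum>x\<in>X. \<Sum>y\<in>Y. ?s x y)")
proof -
  have "bmul \<theta> f g = (\<Sum>x\<in>Poly_Mapping.keys f. \<Sum>y\<in>Y. ?s x y)"
    unfolding bmul_def
    by (intro sum.cong refl sum.mono_neutral_left) (use assms in \<open>auto simp: in_keys_iff\<close>)
  also have "\<dots> = (\<Sum>x\<in>X. \<Sum>y\<in>Y. ?s x y)"
    by (intro sum.mono_neutral_left) (use assms in \<open>auto simp: in_keys_iff intro!: sum.neutral\<close>)
  finally show ?thesis .
qed

lemma bmul_add_left: "bmul \<theta> (f + f') g = bmul \<theta> f g + bmul \<theta> f' g"
proof -
  let ?X = "Poly_Mapping.keys f \<union> Poly_Mapping.keys f'"
  have "bmul \<theta> a g = (\<Sum>x\<in>?X. \<Sum>y\<in>Poly_Mapping.keys g.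
      Poly_Mapping.single (bidx x y) (Poly_Mapping.lookup a x * Poly_Mapping.lookup g y * bcoef \<theta> x y))"
    if "a \<in> {f, f', f + f'}" for a
    by (rule bmul_superset) (use that Poly_Mapping.keys_add[of f f'] in auto)
  then show ?thesis by (simp add: lookup_add distrib_right single_add sum.distrib)
qed

lemma bmul_add_right: "bmul \<theta> f (g + g') = bmul \<theta> f g + bmul \<theta> f g'"
proof -
  let ?Y = "Poly_Mapping.keys g \<union> Poly_Mapping.keys g'"
  have "bmul \<theta> f a = (\<Sum>x\<in>Poly_Mapping.keys f. \<Sum>y\<in>?Y.
      Poly_Mapping.single (bidx x y) (Poly_Mapping.lookup f x * Poly_Mapping.lookup a y * bcoef \<theta> x y))"
    if "a \<in> {g, g', g + g'}" for a
    by (rule bmul_superset) (use that Poly_Mapping.keys_add[of g g'] in auto)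
  then show ?thesis by (simp add: lookup_add distrib_right distrib_left single_add sum.distrib)
qed

lemma bmul_bscale:
  "bmul \<theta> (bscale c f) g = bscale c (bmul \<theta> f g)"
  "bmul \<theta> f (bscale c g) = bscale c (bmul \<theta> f g)"
proof -
  let ?X = "Poly_Mapping.keys f" and ?Y = "Poly_Mapping.keys g"
  have s: "bmul \<theta> a b = (\<Sum>x\<in>?X. \<Sum>y\<in>?Y.
      Poly_Mapping.single (bidx x y) (Poly_Mapping.lookup a x * Poly_Mapping.lookup b y * bcoef \<theta> x y))"
    if "a \<in> {f, bscale c f}" "b \<in> {g, bscale c g}" for a b
    by (rule bmul_superset) (use that keys_bscale[of c f] keys_bscale[of c g] in auto)
  show "bmul \<theta> (bscale c f) g = bscale c (bmul \<theta> f g)"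
    and "bmul \<theta> f (bscale c g) = bscale c (bmul \<theta> f g)"
    by (simp_all add: s bscale_sum bscale_single ac_simps)
qed

lemma bmul_ubas: "bmul \<theta> (ubas g) (ubas h) = bscale (bcoef \<theta> g h) (ubas (bidx g h))"
  by (simp add: bmul_def bscale_single)

lemma lin_bmul:
  "lin L \<Longrightarrow> lin (\<lambda>x. L (bmul \<theta> x y))"
  "lin L \<Longrightarrow> lin (\<lambda>y. L (bmul \<theta> x y))"
  by (simp_all add: lin_def bmul_add_left bmul_add_right bmul_bscale)

section \<open>Cochains and coboundaries in low degrees\<close>

lemma cochains_0: "\<phi> \<in> cochains 0 \<longleftrightarrow> (\<forall>xs. xs \<noteq> [] \<longrightarrow> \<phi> xs = (\<lambda>_. 0)) \<and> lin (\<phi> [])"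
  by (auto simp: cochains_def lin_def)

lemma cochains_1: "\<phi> \<in> cochains (Suc 0) \<longleftrightarrow>
   (\<forall>xs. length xs \<noteq> 1 \<longrightarrow> \<phi> xs = (\<lambda>_. 0)) \<and>
   (\<forall>x. lin (\<phi> [x])) \<and> (\<forall>b. lin (\<lambda>x. \<phi> [x] b))"
  unfolding cochains_def lin_def
  by (auto simp: length_Suc_conv fun_eq_iff)

lemma cochains_2: "\<phi> \<in> cochains 2 \<longleftrightarrow>
   (\<forall>xs. length xs \<noteq> 2 \<longrightarrow> \<phi> xs = (\<lambda>_. 0)) \<and>
   (\<forall>x y. lin (\<phi> [x, y])) \<and> (\<forall>y b. lin (\<lambda>x. \<phi> [x, y] b)) \<and> (\<forall>x b. lin (\<lambda>y. \<phi> [x, y] b))"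
proof -
  have pairs: "(\<forall>xs. length xs = 2 \<longrightarrow> P xs) \<longleftrightarrow> (\<forall>x y. P [x, y])" for P :: "ncz list \<Rightarrow> bool"
    by (auto simp: length_Suc_conv numeral_2_eq_2)
  have less_2: "(\<forall>i<2::nat. P i) \<longleftrightarrow> P 0 \<and> P 1" for P :: "nat \<Rightarrow> bool"
    by (auto simp: less_Suc_eq numeral_2_eq_2)
  show ?thesis
    unfolding cochains_def lin_def mem_Collect_eq pairs less_2
    by (intro iffI; elim conjE; intro conjI allI; simp add: fun_eq_iff)
qed

lemma hcobound_0: "hcobound \<theta> 0 \<phi> [x] = (\<lambda>b. \<phi> [] (bmul \<theta> b x) - \<phi> [] (bmul \<theta> x b))"
  by (simp add: hcobound_def)

lemma hcobound_1: "hcobound \<theta> (Suc 0) \<phi> [x, y] =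
    (\<lambda>b. \<phi> [y] (bmul \<theta> b x) - \<phi> [bmul \<theta> x y] b + \<phi> [x] (bmul \<theta> y b))"
  by (simp add: hcobound_def)

lemma hcobound_2: "hcobound \<theta> 2 \<phi> [x, y, z] =
    (\<lambda>b. \<phi> [y, z] (bmul \<theta> b x) - \<phi> [bmul \<theta> x y, z] b + \<phi> [x, bmul \<theta> y z] b - \<phi> [x, y] (bmul \<theta> z b))"
proof -
  have "{Suc 0..Suc (Suc 0)} = {1::nat, 2}" by auto
  then show ?thesis by (simp add: hcobound_def numeral_2_eq_2 fun_eq_iff)
qed

lemma hcobound_length: "length ys \<noteq> n + 1 \<Longrightarrow> hcobound \<theta> n \<phi> ys = (\<lambda>_. 0)"
  by (auto simp: hcobound_def)

section \<open>Cochains prescribed on basis tuples\<close>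

definition ext1 :: "(idx \<Rightarrow> idx \<Rightarrow> complex) \<Rightarrow> ncz list \<Rightarrow> ncz \<Rightarrow> complex" where
  "ext1 F xs b = (case xs of [x] \<Rightarrow> linext (\<lambda>g. linext (F g) b) x | _ \<Rightarrow> 0)"

definition ext2 :: "(idx \<Rightarrow> idx \<Rightarrow> idx \<Rightarrow> complex) \<Rightarrow> ncz list \<Rightarrow> ncz \<Rightarrow> complex" where
  "ext2 F xs b = (case xs of [x, y] \<Rightarrow> linext (\<lambda>g. linext (\<lambda>h. linext (F g h) b) y) x | _ \<Rightarrow> 0)"

definition ext0 :: "(idx \<Rightarrow> complex) \<Rightarrow> ncz list \<Rightarrow> ncz \<Rightarrow> complex" where
  "ext0 m xs b = (if xs = [] then linext m b else 0)"

text \<open>The case distinctions return 0 on lists of the wrong length, as the convention in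
  \<open>cochains\<close> demands. Hence arbitrary functions on basis tuples give cochains.\<close>

lemma ext_cochains:
  "ext0 m \<in> cochains 0" "ext1 F \<in> cochains (Suc 0)" "ext2 G \<in> cochains 2"
proof -
  have "ext0 m [] = linext m" by (simp add: ext0_def fun_eq_iff)
  then show "ext0 m \<in> cochains 0" by (simp add: cochains_0) (simp add: ext0_def fun_eq_iff)
  have "ext1 F [x] = (\<lambda>b. linext (\<lambda>g. linext (F g) b) x)" for x
    by (simp add: ext1_def fun_eq_iff)
  moreover have "ext1 F xs = (\<lambda>_. 0)" if "length xs \<noteq> 1" for xs
    using that by (auto simp: ext1_def fun_eq_iff split: list.split)
  ultimately show "ext1 F \<in> cochains (Suc 0)"
    by (simp add: cochains_1 lin_linext_arg)
  have "ext2 G [x, y] = (\<lambda>b. linext (\<lambda>g. linext (\<lambda>h. linext (G g h) b) y) x)" for x y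
    by (simp add: ext2_def fun_eq_iff)
  moreover have "ext2 G xs = (\<lambda>_. 0)" if "length xs \<noteq> 2" for xs
    using that by (auto simp: ext2_def fun_eq_iff split: list.split)
  ultimately show "ext2 G \<in> cochains 2"
    by (simp add: cochains_2 lin_linext_arg)
qed

lemma ext_ubas [simp]:
  "ext0 m [] (ubas k) = m k" "ext1 F [ubas g] (ubas k) = F g k" "ext2 G [ubas g, ubas h] (ubas k) = G g h k"
  by (simp_all add: ext0_def ext1_def ext2_def)

section \<open>Reduction of identities to basis elements\<close>

lemma multilin_eq_zero2:
  assumes "\<And>x. lin (F x)" "\<And>b. lin (\<lambda>x. F x b)" "\<And>g k. F (ubas g) (ubas k) = 0"
  shows "F x b = 0"
  by (rule lin_eq_zero[of "\<lambda>x. F x b"], fact, rule lin_eq_zero[of "F _"]) (simp_all add: assms)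

lemma multilin_eq_zero3:
  assumes "\<And>x y. lin (F x y)" "\<And>x b. lin (\<lambda>y. F x y b)" "\<And>y b. lin (\<lambda>x. F x y b)"
    "\<And>g h k. F (ubas g) (ubas h) (ubas k) = 0"
  shows "F x y b = 0"
  by (rule lin_eq_zero[of "\<lambda>x. F x y b"], fact, rule multilin_eq_zero2[of "F _"]) (simp_all add: assms)

lemma multilin_eq_zero4:
  assumes "\<And>x y z. lin (F x y z)" "\<And>x y b. lin (\<lambda>z. F x y z b)" "\<And>x z b. lin (\<lambda>y. F x y z b)"
    "\<And>y z b. lin (\<lambda>x. F x y z b)" "\<And>g h l k. F (ubas g) (ubas h) (ubas l) (ubas k) = 0"
  shows "F x y z b = 0"
  by (rule lin_eq_zero[of "\<lambda>x. F x y z b"], fact, rule multilin_eq_zero3[of "F _"]) (simp_all add: assms)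

lemma cochain_eqI_0:
  assumes "\<phi> \<in> cochains 0" "\<psi> \<in> cochains 0" "\<And>k. \<phi> [] (ubas k) = \<psi> [] (ubas k)"
  shows "\<phi> = \<psi>"
proof (intro HOL.ext)
  fix xs :: "ncz list" and b
  have "\<phi> [] b - \<psi> [] b = 0"
    by (rule lin_eq_zero[of "\<lambda>b. \<phi> [] b - \<psi> [] b"]; insert assms; simp add: cochains_0 lin_comb(3))
  then show "\<phi> xs b = \<psi> xs b"
    using assms by (cases "xs = []") (auto simp: cochains_0)
qed

lemma cochain_eqI_1:
  assumes "\<phi> \<in> cochains (Suc 0)" "\<psi> \<in> cochains (Suc 0)" "\<And>g k. \<phi> [ubas g] (ubas k) = \<psi> [ubas g] (ubas k)"
  shows "\<phi> = \<psi>"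
proof (intro HOL.ext)
  fix xs :: "ncz list" and b
  have "\<phi> [x] b - \<psi> [x] b = 0" for x
    by (rule multilin_eq_zero2[of "\<lambda>x b. \<phi> [x] b - \<psi> [x] b"]; insert assms; simp add: cochains_1 lin_comb(3))
  then have eq: "\<phi> [x] b = \<psi> [x] b" for x by simp
  show "\<phi> xs b = \<psi> xs b"
  proof (cases "length xs = 1")
    case True
    then obtain x where "xs = [x]" by (auto simp: length_Suc_conv)
    then show ?thesis by (simp add: eq)
  next
    case False
    then have "\<phi> xs = (\<lambda>_. 0)" "\<psi> xs = (\<lambda>_. 0)"
      using assms(1,2) unfolding cochains_1 by blast+
    then show ?thesis by simp
  qed
qed

lemma cochain_eqI_2:
  assumes "\<phi> \<in> cochains 2" "\<psi> \<in> cochains 2"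
    "\<And>g h k. \<phi> [ubas g, ubas h] (ubas k) = \<psi> [ubas g, ubas h] (ubas k)"
  shows "\<phi> = \<psi>"
proof (intro HOL.ext)
  fix xs :: "ncz list" and b
  have "\<phi> [x, y] b - \<psi> [x, y] b = 0" for x y
    by (rule multilin_eq_zero3[of "\<lambda>x y b. \<phi> [x, y] b - \<psi> [x, y] b"]; insert assms; simp add: cochains_2 lin_comb(3))
  then have eq: "\<phi> [x, y] b = \<psi> [x, y] b" for x y by simp
  show "\<phi> xs b = \<psi> xs b"
  proof (cases "length xs = 2")
    case True
    then obtain x y where "xs = [x, y]" by (auto simp: length_Suc_conv numeral_2_eq_2)
    then show ?thesis by (simp add: eq)
  next
    case False
    then have "\<phi> xs = (\<lambda>_. 0)" "\<psi> xs = (\<lambda>_. 0)"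
      using assms(1,2) unfolding cochains_2 by blast+
    then show ?thesis by simp
  qed
qed

lemma hcobound_0_cochain:
  assumes "\<phi> \<in> cochains 0" shows "hcobound \<theta> 0 \<phi> \<in> cochains (Suc 0)"
proof -
  have "lin (\<phi> [])" using assms by (simp add: cochains_0)
  note L = lin_bmul[OF this] lin_comb(3)
  show ?thesis by (simp add: cochains_1 hcobound_0 hcobound_length L)
qed

lemma hcobound_1_cochain:
  assumes "\<phi> \<in> cochains (Suc 0)" shows "hcobound \<theta> (Suc 0) \<phi> \<in> cochains 2"
proof -
  have l: "lin (\<phi> [x])" "lin (\<lambda>x. \<phi> [x] b)" for x b using assms by (simp_all add: cochains_1)
  note L = l lin_bmul[OF l(1)] lin_bmul[OF l(2)] lin_comb(2,3)
  show ?thesis by (simp add: cochains_2 hcobound_1 hcobound_length L)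
qed

lemma hcobound_2_eq_zeroI:
  assumes "\<phi> \<in> cochains 2" "\<And>g h l k. hcobound \<theta> 2 \<phi> [ubas g, ubas h, ubas l] (ubas k) = 0"
  shows "hcobound \<theta> 2 \<phi> = (\<lambda>_ _. 0)"
proof (intro HOL.ext)
  fix xs :: "ncz list" and b
  have l: "lin (\<phi> [x, y])" "lin (\<lambda>x. \<phi> [x, y] b)" "lin (\<lambda>y. \<phi> [x, y] b)" for x y b
    using assms by (simp_all add: cochains_2)
  note L = l lin_bmul[OF l(1)] lin_bmul[OF l(2)] lin_bmul[OF l(3)] lin_comb(2,3)
  have "hcobound \<theta> 2 \<phi> [x, y, z] b = 0" for x y z
    by (rule multilin_eq_zero4[of "\<lambda>x y z b. hcobound \<theta> 2 \<phi> [x, y, z] b", OF _ _ _ _ assms(2)])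
       (simp_all add: hcobound_2 L)
  moreover have "length xs = 3 \<Longrightarrow> \<exists>x y z. xs = [x, y, z]"
    by (auto simp: length_Suc_conv numeral_3_eq_3)
  moreover have "length xs \<noteq> 3 \<Longrightarrow> hcobound \<theta> 2 \<phi> xs = (\<lambda>_. 0)"
    by (rule hcobound_length) simp
  ultimately show "hcobound \<theta> 2 \<phi> xs b = 0"
    by (cases "length xs = 3") auto
qed

lemma hcobound_1_eq_zeroI:
  assumes "\<phi> \<in> cochains (Suc 0)" "\<And>g h k. hcobound \<theta> (Suc 0) \<phi> [ubas g, ubas h] (ubas k) = 0"
  shows "hcobound \<theta> (Suc 0) \<phi> = (\<lambda>_ _. 0)"
  by (rule cochain_eqI_2[OF hcobound_1_cochain[OF assms(1)]])
     (simp_all add: assms(2) cochains_2 lin_comb(1))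

lemma hcobound_0_eq_zeroI:
  assumes "\<phi> \<in> cochains 0" "\<And>g k. hcobound \<theta> 0 \<phi> [ubas g] (ubas k) = 0"
  shows "hcobound \<theta> 0 \<phi> = (\<lambda>_ _. 0)"
  by (rule cochain_eqI_1[OF hcobound_0_cochain[OF assms(1)]])
     (simp_all add: assms(2) cochains_1 lin_comb(1))

section \<open>The conjugation action on functionals\<close>

text \<open>Elements of the t-coset of Z^2 x| Z_2 are involutions, hence their own inverses.\<close>

definition ginv :: "idx \<Rightarrow> idx" where
  "ginv x = (case x of (a, b, e) \<Rightarrow> if e then x else (- a, - b, e))"

definition gone :: idx where "gone = (0, 0, False)"

definition gt :: idx where "gt = (0, 0, True)"

definition gU1 :: idx where "gU1 = (1, 0, False)"

definition gU2 :: idx where "gU2 = (0, 1, False)"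

text \<open>An integer-valued 2-cocycle of the group for the trivial action. It is the exponent of
  lam in the product and, multiplied by the trace, also yields the generator in degree 2.\<close>

definition bexp :: "idx \<Rightarrow> idx \<Rightarrow> int" where
  "bexp x y = (case x of (a,b,e) \<Rightarrow> case y of (c,d,f) \<Rightarrow> b * (if e then -c else c))"

definition aexp :: "idx \<Rightarrow> idx \<Rightarrow> int" where
  "aexp g x = bexp (bidx (ginv g) x) g - bexp g (bidx (ginv g) x)"

text \<open>Extending m linearly, (act g m)(x) = m(u_g^-1 u_x u_g); aexp g x is the exponent of the
scalar that appears when u_g^-1 u_x u_g is written as a multiple of a basis element.\<close>

definition act :: "real \<Rightarrow> idx \<Rightarrow> (idx \<Rightarrow> complex) \<Rightarrow> idx \<Rightarrow> complex" where
  "act \<theta> g m = (\<lambda>x. lam \<theta> powi aexp g x * m (bidx (bidx (ginv g) x) g))"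

lemma bcoef_bexp: "bcoef \<theta> x y = lam \<theta> powi bexp x y"
  by (simp add: bcoef_def bexp_def split: prod.splits)

lemma lam_nz [simp]: "lam \<theta> \<noteq> 0"
  by (simp add: lam_def)

lemma powi_add: "lam \<theta> powi (m + n) = lam \<theta> powi m * lam \<theta> powi n"
  by (simp add: power_int_add)

lemma bidx_simps [simp]:
  "bidx (a, b, False) (c, d, f) = (a + c, b + d, f)"
  "bidx (a, b, True) (c, d, f) = (a - c, b - d, \<not> f)"
  by (simp_all add: bidx_def)

lemma ginv_simps [simp]: "ginv (a, b, False) = (- a, - b, False)" "ginv (a, b, True) = (a, b, True)"
  by (simp_all add: ginv_def)

lemma bexp_simps [simp]: "bexp (a, b, False) (c, d, f) = b * c" "bexp (a, b, True) (c, d, f) = - (b * c)"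
  by (simp_all add: bexp_def)

lemma idx_cases: "(\<And>a b. x = (a, b, False) \<Longrightarrow> P) \<Longrightarrow> (\<And>a b. x = (a, b, True) \<Longrightarrow> P) \<Longrightarrow> P"
  for x :: idx
  by (metis prod_cases3)

lemma bidx_assoc: "bidx (bidx x y) z = bidx x (bidx y z)"
  by (cases x rule: idx_cases; cases y rule: idx_cases; cases z rule: idx_cases; simp)

lemma bidx_gone [simp]: "bidx gone x = x" "bidx x gone = x"
  by (cases x rule: idx_cases; simp add: gone_def)+

lemma bidx_ginv [simp]: "bidx (ginv x) x = gone" "bidx x (ginv x) = gone"
  by (cases x rule: idx_cases; simp add: gone_def)+

lemma bidx_ginv_cancel [simp]: "bidx (ginv x) (bidx x y) = y" "bidx x (bidx (ginv x) y) = y"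
  by (simp_all flip: bidx_assoc)

text \<open>Additive form of the associativity (u_g u_h) u_k = u_g (u_h u_k).\<close>

lemma bexp_cocycle: "bexp g h + bexp (bidx g h) k = bexp h k + bexp g (bidx h k)"
  by (cases g rule: idx_cases; cases h rule: idx_cases; cases k rule: idx_cases; simp add: algebra_simps)

text \<open>This makes \<open>act\<close> a left action: conjugation by u_g u_h is carried out in
  two stages, and the scalar relating u_g u_h to a basis element cancels.\<close>

lemma aexp_bidx: "aexp (bidx g h) x = aexp g x + aexp h (bidx (bidx (ginv g) x) g)"
  unfolding aexp_def
  by (cases g rule: idx_cases; cases h rule: idx_cases; cases x rule: idx_cases; simp add: algebra_simps)

lemma act_act: "act \<theta> g (act \<theta> h m) = act \<theta> (bidx g h) m"
proof
  fix x
  have "bidx (bidx (ginv h) (bidx (bidx (ginv g) x) g)) h = bidx (bidx (ginv (bidx g h)) x) (bidx g h)"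
    by (cases g rule: idx_cases; cases h rule: idx_cases; cases x rule: idx_cases; simp)
  then show "act \<theta> g (act \<theta> h m) x = act \<theta> (bidx g h) m x"
    by (simp add: act_def aexp_bidx powi_add)
qed

lemma act_gone [simp]: "act \<theta> gone m = m"
proof
  fix x show "act \<theta> gone m x = m x"
    by (cases x rule: idx_cases; simp add: act_def aexp_def gone_def)
qed

lemma act_add: "act \<theta> g (m + n) = act \<theta> g m + act \<theta> g n"
  and act_diff: "act \<theta> g (m - n) = act \<theta> g m - act \<theta> g n"
  and act_uminus: "act \<theta> g (- m) = - act \<theta> g m"
  and act_zero: "act \<theta> g 0 = 0"
  by (simp_all add: act_def fun_eq_iff algebra_simps)

lemmas act_linear = act_add act_diff act_uminus act_zero

section \<open>Halves and multiples of the trace\<close>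

definition half :: "(idx \<Rightarrow> complex) \<Rightarrow> idx \<Rightarrow> complex" where
  "half m = (\<lambda>x. m x / 2)"

lemma half_simps:
  "half m + half m = m" "half (m + n) = half m + half n" "half (m - n) = half m - half n"
  "half (- m) = - half m" "act \<theta> g (half m) = half (act \<theta> g m)"
  by (simp_all add: half_def act_def fun_eq_iff add_divide_distrib diff_divide_distrib)

text \<open>This is c times the canonical trace, which reads off the coefficient of the
  unit.\<close>

definition delta0 :: "complex \<Rightarrow> idx \<Rightarrow> complex" where
  "delta0 c = (\<lambda>x. if x = gone then c else 0)"

text \<open>Conjugation fixes the unit without producing a scalar. Evaluation at \<open>gone\<close>
  therefore turns identities with twisted coefficients into identities with trivial ones.\<close>

lemma act_at_gone: "act \<theta> g m gone = m gone"
  by (cases g rule: idx_cases; simp add: act_def aexp_def gone_def)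

lemma act_delta0: "act \<theta> g (delta0 c) = delta0 c"
proof
  fix x
  have "bidx (bidx (ginv g) x) g = gone \<longleftrightarrow> x = gone"
    by (cases g rule: idx_cases; cases x rule: idx_cases; auto simp: gone_def)
  then show "act \<theta> g (delta0 c) x = delta0 c x"
    using act_at_gone[of \<theta> g "delta0 c"] by (simp add: act_def delta0_def)
qed

text \<open>On the Z^2-part the generators act diagonally; for irrational theta both eigenvalues are
  1 only at p = q = 0. On the t-part they translate by 2 up to a phase.\<close>

lemma act_U:
  "act \<theta> gU1 m (p, q, False) = lam \<theta> powi q * m (p, q, False)"
  "act \<theta> gU2 m (p, q, False) = lam \<theta> powi (- p) * m (p, q, False)"
  "act \<theta> gU1 m (p, q, True) = lam \<theta> powi (- q) * m (p - 2, q, True)"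
  "act \<theta> gU2 m (p, q, True) = lam \<theta> powi (- p) * m (p, q - 2, True)"
  by (simp_all add: act_def aexp_def gU1_def gU2_def algebra_simps)

lemma act_t: "act \<theta> gt m (p, q, e) = m (- p, - q, e)"
  by (cases e; simp add: act_def aexp_def gt_def)

lemma lam_powi_eq_1:
  assumes "\<theta> \<notin> \<rat>" "lam \<theta> powi n = 1"
  shows "n = 0"
proof (rule ccontr)
  assume n: "n \<noteq> 0"
  have "cis (of_int n * (2 * pi * \<theta>)) = 1"
    using assms(2) by (simp add: lam_def cis_power_int)
  then obtain k where "of_int n * (2 * pi * \<theta>) = of_int k * (2 * pi)"
    by (auto simp: complex_eq_iff cos_one_2pi_int)
  then have "\<theta> = of_int k / of_int n" using n by (simp add: field_simps)
  then show False using assms(1) by auto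
qed

text \<open>The phase that turns the action of U1 and U2 on functionals supported on the t-part into
translations by 2: it is the inverse of a square root of lam to the power pq.\<close>

definition tw :: "real \<Rightarrow> int \<Rightarrow> int \<Rightarrow> complex" where
  "tw \<theta> p q = cis (pi * \<theta>) powi (- (p * q))"

lemma tw_nz [simp]: "tw \<theta> p q \<noteq> 0"
  by (simp add: tw_def)

lemma tw_shift:
  "lam \<theta> powi (- q) * tw \<theta> (p - 2) q = tw \<theta> p q"
  "lam \<theta> powi (- p) * tw \<theta> p (q - 2) = tw \<theta> p q"
proof -
  have l: "lam \<theta> powi n = cis (pi * \<theta>) powi (2 * n)" for n
    by (simp add: lam_def cis_power_int algebra_simps)
  show "lam \<theta> powi (- q) * tw \<theta> (p - 2) q = tw \<theta> p q"
    "lam \<theta> powi (- p) * tw \<theta> p (q - 2) = tw \<theta> p q"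
    by (simp_all add: l tw_def power_int_add[symmetric] algebra_simps)
qed

lemma tw_act_U:
  "act \<theta> gU1 m (p, q, True) / tw \<theta> p q = m (p - 2, q, True) / tw \<theta> (p - 2) q"
  "act \<theta> gU2 m (p, q, True) / tw \<theta> p q = m (p, q - 2, True) / tw \<theta> p (q - 2)"
  unfolding act_U
  by (simp add: tw_shift(1)[of \<theta> q p, symmetric], simp add: tw_shift(2)[of \<theta> p q, symmetric])

section \<open>Difference equations with step 2\<close>

lemma shift2_periodic:
  fixes f :: "int \<Rightarrow> 'a"
  assumes "\<And>p. f p = f (p - 2)"
  shows "f p = f (p mod 2)"
proof -
  have "f (2 * n + e) = f e" for n e
  proof (induction n rule: int_induct[of _ 0])
    case (step1 i)
    then show ?case using assms[of "2 * (i + 1) + e"] by (simp add: algebra_simps)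
  next
    case (step2 i)
    then show ?case using assms[of "2 * i + e"] by (simp add: algebra_simps)
  qed simp
  from this[of "p div 2" "p mod 2"] show ?thesis by simp
qed

text \<open>A discrete antiderivative for step 2, normalised to vanish at 0 and 1. At least one of
  the two ranges is empty; the second one, with its minus sign, serves negative p.\<close>

definition sum2 :: "(int \<Rightarrow> complex) \<Rightarrow> int \<Rightarrow> complex" where
  "sum2 r p = (\<Sum>i\<in>{1..p div 2}. r (2 * i + p mod 2)) - (\<Sum>i\<in>{p div 2 + 1..0}. r (2 * i + p mod 2))"

lemma sum2_diff: "sum2 r p - sum2 r (p - 2) = r p"
proof -
  define j e where "j = p div 2" and "e = p mod 2"
  have p: "p = 2 * j + e" "(p - 2) div 2 = j - 1" "(p - 2) mod 2 = e"
    by (auto simp: j_def e_def)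
  have "{1..j} = insert j {1..j-1}" if "j \<ge> 1" using that by auto
  moreover have "{j..0} = insert j {j+1..0}" if "j \<le> 0" using that by auto
  ultimately show ?thesis
    unfolding sum2_def p(2,3) j_def[symmetric] e_def[symmetric]
    by (cases "j \<ge> 1") (simp_all add: p(1))
qed

lemma sum2_mod: "sum2 r (p mod 2) = 0"
  by (simp add: sum2_def)

text \<open>Two solutions of the difference equation differ by a function of period 2, and
  \<open>sum2\<close> vanishes at the residues 0 and 1.\<close>

lemma sum2_unique:
  assumes "\<And>p. f p - f (p - 2) = r p"
  shows "f p = sum2 r p + f (p mod 2)"
proof -
  have "f p - sum2 r p = f (p - 2) - sum2 r (p - 2)" for p
    using assms[of p] sum2_diff[of r p] by (simp add: algebra_simps)
  from shift2_periodic[of "\<lambda>p. f p - sum2 r p", OF this, of p] show ?thesis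
    by (simp add: sum2_mod algebra_simps)
qed

text \<open>Translations by 2 act freely on Z^2, so the functions form a coinduced module and the
  first cohomology vanishes. Explicitly, \<open>c2\<close> is summed along q on the strip of
  residues of p, and \<open>c1\<close> is then summed along p from that strip.\<close>

lemma translation_H1:
  fixes c1 c2 :: "int \<Rightarrow> int \<Rightarrow> complex"
  assumes "\<And>p q. c1 p q - c1 p (q - 2) = c2 p q - c2 (p - 2) q"
  obtains m where "\<And>p q. m p q - m (p - 2) q = c1 p q" "\<And>p q. m p q - m p (q - 2) = c2 p q"
proof
  let ?m = "\<lambda>p q. sum2 (\<lambda>p. c1 p q) p + sum2 (\<lambda>q. c2 (p mod 2) q) q"
  fix p q
  show "?m p q - ?m (p - 2) q = c1 p q"
    using sum2_diff[of "\<lambda>p. c1 p q" p] by simp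
  \<comment> \<open>\<open>c2\<close> is rebuilt from its differences in p. Compatibility exchanges
    these for differences of \<open>c1\<close> in q, which is how the first summand of the solution
    contributes.\<close>
  have "c2 p q = sum2 (\<lambda>p. c2 p q - c2 (p - 2) q) p + c2 (p mod 2) q"
    by (rule sum2_unique) simp
  also have "(\<lambda>p. c2 p q - c2 (p - 2) q) = (\<lambda>p. c1 p q - c1 p (q - 2))" by (simp add: assms)
  also have "sum2 \<dots> p = sum2 (\<lambda>p. c1 p q) p - sum2 (\<lambda>p. c1 p (q - 2)) p"
    by (simp add: sum2_def sum_subtractf)
  finally show "?m p q - ?m p (q - 2) = c2 p q"
    using sum2_diff[of "\<lambda>q. c2 (p mod 2) q" q] by simp
qed

section \<open>Solving the equations for U1 and U2\<close>

lemma divide_solve: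
  fixes a b u v :: complex
  assumes "1 - u \<noteq> 0" "(1 - v) * a = (1 - u) * b"
  shows "a / (1 - u) - v * (a / (1 - u)) = b"
proof -
  have "a / (1 - u) - v * (a / (1 - u)) = (1 - v) * a / (1 - u)"
    by (simp only: left_diff_distrib mult_1 diff_divide_distrib times_divide_eq_right)
  then show ?thesis using assms by simp
qed

text \<open>The hypothesis \<open>comp\<close> is what U1 U2 = U2 U1 imposes on the values of a
  crossed homomorphism at the generators. At the unit both operators 1 - U_i vanish, so there the
  right-hand sides must be 0.\<close>

lemma solve_H1:
  assumes irr: "\<theta> \<notin> \<rat>" and comp: "c1 - act \<theta> gU2 c1 = c2 - act \<theta> gU1 c2"
    and z: "c1 gone = 0" "c2 gone = 0"
  obtains m where "m - act \<theta> gU1 m = c1" "m - act \<theta> gU2 m = c2"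
proof -
  have comp': "c1 x - act \<theta> gU2 c1 x = c2 x - act \<theta> gU1 c2 x" for x
    using fun_cong[OF comp, of x] by simp
  have "c1 (p, q, True) / tw \<theta> p q - c1 (p, q - 2, True) / tw \<theta> p (q - 2) =
    c2 (p, q, True) / tw \<theta> p q - c2 (p - 2, q, True) / tw \<theta> (p - 2) q" for p q
    using comp'[of "(p, q, True)"] unfolding tw_act_U[symmetric] by (simp flip: diff_divide_distrib)
  from translation_H1[of "\<lambda>p q. c1 (p, q, True) / tw \<theta> p q" "\<lambda>p q. c2 (p, q, True) / tw \<theta> p q", OF this]
  obtain n where n: "\<And>p q. n p q - n (p - 2) q = c1 (p, q, True) / tw \<theta> p q"
    "\<And>p q. n p q - n p (q - 2) = c2 (p, q, True) / tw \<theta> p q" by metis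
  \<comment> \<open>On the Z^2-part the equation is divided by 1 minus an eigenvalue different from
    1: that of U1 if q is non-zero, otherwise that of U2. On the t-part the phase is restored to the
    solution of the untwisted equations.\<close>
  define m :: "idx \<Rightarrow> complex" where "m = (\<lambda>(p, q, e). if e then tw \<theta> p q * n p q
      else if q \<noteq> 0 then c1 (p, q, False) / (1 - lam \<theta> powi q)
      else if p \<noteq> 0 then c2 (p, q, False) / (1 - lam \<theta> powi (- p)) else 0)"
  have nz: "k \<noteq> 0 \<Longrightarrow> 1 - lam \<theta> powi k \<noteq> 0" for k
    using lam_powi_eq_1[OF irr, of k] by auto
  have F: "(m - act \<theta> gU1 m) (p, q, False) = c1 (p, q, False) \<and>
      (m - act \<theta> gU2 m) (p, q, False) = c2 (p, q, False)" for p q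
  proof -
    \<comment> \<open>Compatibility at a fixed character: a quotient solving the equation for U1
      also solves that for U2, and for q = 0 and p non-zero it forces the value of \<open>c1\<close>
      to be 0.\<close>
    have cc: "(1 - lam \<theta> powi (- p)) * c1 (p, q, False) = (1 - lam \<theta> powi q) * c2 (p, q, False)"
      using comp'[of "(p, q, False)"] by (simp add: act_U algebra_simps)
    consider "q \<noteq> 0" | "q = 0" "p \<noteq> 0" | "q = 0" "p = 0" by auto
    then show ?thesis
    proof cases
      case 1
      then show ?thesis
        using divide_solve[OF nz[of q] cc] divide_solve[OF nz[of q] refl, of "c1 (p, q, False)"]
        by (simp add: act_U m_def)
    next
      case 2
      then have "c1 (p, q, False) = 0" using cc nz[of "- p"] by simp
      then show ?thesis
        using 2 divide_solve[OF nz[of "- p"] refl, of "c2 (p, q, False)"] by (simp add: act_U m_def)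
    next
      case 3
      then show ?thesis using z by (simp add: act_U m_def gone_def)
    qed
  qed
  have T: "(m - act \<theta> gU1 m) (p, q, True) = c1 (p, q, True) \<and>
      (m - act \<theta> gU2 m) (p, q, True) = c2 (p, q, True)" for p q
  proof -
    have "(m - act \<theta> gU1 m) (p, q, True) / tw \<theta> p q = c1 (p, q, True) / tw \<theta> p q"
      "(m - act \<theta> gU2 m) (p, q, True) / tw \<theta> p q = c2 (p, q, True) / tw \<theta> p q"
      by (simp_all add: diff_divide_distrib tw_act_U flip: n) (simp_all add: m_def)
    then show ?thesis by simp
  qed
  have "m - act \<theta> gU1 m = c1" "m - act \<theta> gU2 m = c2"
  proof -
    have "(m - act \<theta> gU1 m) x = c1 x" "(m - act \<theta> gU2 m) x = c2 x" for x
      by (cases x rule: idx_cases; use F T in blast)+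
    then show "m - act \<theta> gU1 m = c1" "m - act \<theta> gU2 m = c2" by blast+
  qed
  then show ?thesis by (rule that)
qed

text \<open>One equation in two unknowns. The unknown \<open>m1\<close> alone solves it on the
  t-part, by summation along q, and at p non-zero; \<open>m2\<close> takes over at p = 0 and q
  non-zero. Only the value of r at the unit is left, as both operators vanish there.\<close>

lemma solve_H2:
  assumes irr: "\<theta> \<notin> \<rat>"
  obtains m1 m2 where "(m1 - act \<theta> gU2 m1) - (m2 - act \<theta> gU1 m2) = r - delta0 (r gone)"
proof -
  define m1 :: "idx \<Rightarrow> complex" where "m1 = (\<lambda>(p, q, e).
      if e then tw \<theta> p q * sum2 (\<lambda>q. r (p, q, True) / tw \<theta> p q) q
      else if p \<noteq> 0 then r (p, q, False) / (1 - lam \<theta> powi (- p)) else 0)"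
  define m2 :: "idx \<Rightarrow> complex" where "m2 = (\<lambda>(p, q, e).
      if e then 0 else if p = 0 \<and> q \<noteq> 0 then - r (p, q, False) / (1 - lam \<theta> powi q) else 0)"
  have nz: "k \<noteq> 0 \<Longrightarrow> 1 - lam \<theta> powi k \<noteq> 0" for k
    using lam_powi_eq_1[OF irr, of k] by auto
  have "((m1 - act \<theta> gU2 m1) - (m2 - act \<theta> gU1 m2)) x = (r - delta0 (r gone)) x" for x
  proof (cases x rule: idx_cases)
    case (1 p q)
    consider "p \<noteq> 0" | "p = 0" "q \<noteq> 0" | "p = 0" "q = 0" by auto
    then show ?thesis
      by cases (use divide_solve[OF nz[of "- p"] refl, of "r x"]
          divide_solve[OF nz[of q] refl, of "r x"] in
        \<open>simp_all add: 1 act_U m1_def m2_def delta0_def gone_def\<close>)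
  next
    case (2 p q)
    have "(m1 - act \<theta> gU2 m1) x / tw \<theta> p q = r x / tw \<theta> p q"
      using sum2_diff[of "\<lambda>q. r (p, q, True) / tw \<theta> p q" q]
      by (simp add: 2 diff_divide_distrib tw_act_U) (simp add: m1_def)
    moreover have "(m2 - act \<theta> gU1 m2) x = 0" by (simp add: 2 act_U m2_def)
    ultimately show ?thesis by (simp add: 2 delta0_def gone_def)
  qed
  then have "(m1 - act \<theta> gU2 m1) - (m2 - act \<theta> gU1 m2) = r - delta0 (r gone)" by blast
  then show ?thesis by (rule that)
qed

section \<open>The extension defined by a 2-cocycle\<close>

context group begin

lemma intertwine_nat:
  assumes "x \<in> carrier G" "y \<in> carrier G" "z \<in> carrier G" "x \<otimes> y = z \<otimes> x"
  shows "x \<otimes> y [^] (n::nat) = z [^] n \<otimes> x"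
proof (induction n)
  case (Suc n)
  have "x \<otimes> y [^] Suc n = (x \<otimes> y [^] n) \<otimes> y" using assms by (simp add: m_assoc)
  also have "\<dots> = z [^] n \<otimes> (x \<otimes> y)" using assms Suc by (simp add: m_assoc)
  also have "\<dots> = z [^] Suc n \<otimes> x" using assms by (simp add: m_assoc)
  finally show ?case .
qed (use assms in simp)

lemma intertwine_inv:
  assumes "x \<in> carrier G" "y \<in> carrier G" "z \<in> carrier G" "x \<otimes> y = z \<otimes> x"
  shows "x \<otimes> inv y = inv z \<otimes> x"
proof -
  have "z \<otimes> (x \<otimes> inv y) = z \<otimes> x \<otimes> inv y"
    using assms by (simp add: m_assoc)
  also have "\<dots> = x \<otimes> y \<otimes> inv y" by (simp only: assms(4))
  also have "\<dots> = x" using assms(1-3) by (simp add: m_assoc)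
  finally show ?thesis using assms
    by (metis inv_closed inv_solve_left m_closed)
qed

lemma intertwine_int:
  assumes "x \<in> carrier G" "y \<in> carrier G" "z \<in> carrier G" "x \<otimes> y = z \<otimes> x"
  shows "x \<otimes> y [^] (n::int) = z [^] n \<otimes> x"
proof (cases n rule: int_cases2)
  case (nonneg k)
  then show ?thesis using intertwine_nat[OF assms, of k] by (simp add: int_pow_int)
next
  case (nonpos k)
  then show ?thesis
    using intertwine_inv[OF _ _ _ intertwine_nat[OF assms, of k]] assms by (simp add: int_pow_neg_int)
qed

text \<open>The hypotheses are the defining relations of the crossed product with Z in the place of
  lam. The normal form computation that gives the exponent \<open>bexp\<close> in the crossed
  product therefore works in G as well.\<close>

lemma dihedral_section_mult:
  assumes cl [simp]: "V1 \<in> carrier G" "V2 \<in> carrier G" "T \<in> carrier G" "Z \<in> carrier G"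
    and Z: "V1 \<otimes> Z = Z \<otimes> V1" "V2 \<otimes> Z = Z \<otimes> V2"
    and comm: "V2 \<otimes> V1 = Z \<otimes> V1 \<otimes> V2"
    and T: "T \<otimes> T = \<one>" "T \<otimes> V1 = inv V1 \<otimes> T" "T \<otimes> V2 = inv V2 \<otimes> T"
  defines "s \<equiv> \<lambda>(a::int, b::int, e). V1 [^] a \<otimes> V2 [^] b \<otimes> (if e then T else \<one>)"
  shows "s g \<otimes> s h = Z [^] bexp g h \<otimes> s (bidx g h)"
proof -
  have V1Z: "V1 [^] a \<otimes> Z [^] n = Z [^] n \<otimes> V1 [^] a" for a n :: int
  proof -
    have "Z \<otimes> V1 [^] a = V1 [^] a \<otimes> Z" by (rule intertwine_int) (simp_all add: Z)
    from intertwine_int[OF _ _ _ this[symmetric]] show ?thesis by simp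
  qed
  have "V2 \<otimes> V1 [^] c = (Z \<otimes> V1) [^] c \<otimes> V2" for c :: int
    by (rule intertwine_int) (simp_all add: comm)
  then have "V2 \<otimes> V1 [^] c = Z [^] c \<otimes> V1 [^] c \<otimes> V2" for c :: int
    by (simp add: int_pow_mult_distrib Z)
  \<comment> \<open>The relation is turned around to describe the conjugation of V2 by a power of
    V1, so that \<open>intertwine_int\<close> can next be applied to powers of V2.\<close>
  then have 1: "V1 [^] c \<otimes> V2 = (Z [^] (- c) \<otimes> V2) \<otimes> V1 [^] c" for c :: int
    by (simp add: m_assoc int_pow_neg inv_solve_left)
  have V2Z: "V2 \<otimes> Z [^] n = Z [^] n \<otimes> V2" for n :: int
    by (rule intertwine_int) (simp_all add: Z)
  have "V1 [^] c \<otimes> V2 [^] b = (Z [^] (- c) \<otimes> V2) [^] b \<otimes> V1 [^] c" for b c :: int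
    by (rule intertwine_int) (simp_all add: 1)
  then have "V1 [^] c \<otimes> V2 [^] b = Z [^] (- c * b) \<otimes> V2 [^] b \<otimes> V1 [^] c" for b c :: int
    by (simp add: int_pow_mult_distrib V2Z int_pow_pow)
  then have swap: "V2 [^] b \<otimes> V1 [^] c = Z [^] (b * c) \<otimes> (V1 [^] c \<otimes> V2 [^] b)" for b c :: int
    by (simp add: m_assoc int_pow_neg inv_solve_left mult.commute)
  have F: "V1 [^] a \<otimes> V2 [^] b \<otimes> (V1 [^] c \<otimes> V2 [^] d) =
      Z [^] (b * c) \<otimes> (V1 [^] (a + c) \<otimes> V2 [^] (b + d))" for a b c d :: int
  proof -
    have "V1 [^] a \<otimes> V2 [^] b \<otimes> (V1 [^] c \<otimes> V2 [^] d) =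
        V1 [^] a \<otimes> (V2 [^] b \<otimes> V1 [^] c) \<otimes> V2 [^] d" by (simp add: m_assoc)
    also have "\<dots> = (V1 [^] a \<otimes> Z [^] (b * c)) \<otimes> (V1 [^] c \<otimes> (V2 [^] b \<otimes> V2 [^] d))"
      by (simp add: m_assoc swap)
    also have "\<dots> = Z [^] (b * c) \<otimes> ((V1 [^] a \<otimes> V1 [^] c) \<otimes> (V2 [^] b \<otimes> V2 [^] d))"
      by (simp add: m_assoc V1Z)
    finally show ?thesis by (simp add: int_pow_mult)
  qed
  have T': "T \<otimes> (V1 [^] c \<otimes> V2 [^] d) = V1 [^] (- c) \<otimes> V2 [^] (- d) \<otimes> T" for c d :: int
  proof -
    have "T \<otimes> (V1 [^] c \<otimes> V2 [^] d) = (T \<otimes> V1 [^] c) \<otimes> V2 [^] d" by (simp add: m_assoc)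
    also have "T \<otimes> V1 [^] c = inv V1 [^] c \<otimes> T" by (rule intertwine_int) (simp_all add: T)
    also have "\<dots> \<otimes> V2 [^] d = inv V1 [^] c \<otimes> (T \<otimes> V2 [^] d)" by (simp add: m_assoc)
    also have "T \<otimes> V2 [^] d = inv V2 [^] d \<otimes> T" by (rule intertwine_int) (simp_all add: T)
    finally show ?thesis by (simp add: m_assoc int_pow_inv int_pow_neg)
  qed
  obtain a b e c d f where gh: "g = (a, b, e)" "h = (c, d, f)" by (metis prod_cases3)
  let ?t = "\<lambda>e. if e then T else \<one>"
  show ?thesis
  proof (cases e)
    case False
    have "s g \<otimes> s h = V1 [^] a \<otimes> V2 [^] b \<otimes> (V1 [^] c \<otimes> V2 [^] d) \<otimes> ?t f"
      using False by (simp add: gh s_def m_assoc)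
    also have "\<dots> = Z [^] (b * c) \<otimes> s (a + c, b + d, f)"
      unfolding F by (simp add: s_def m_assoc)
    finally show ?thesis using False by (simp add: gh)
  next
    case True
    have "s g \<otimes> s h = V1 [^] a \<otimes> V2 [^] b \<otimes> (T \<otimes> (V1 [^] c \<otimes> V2 [^] d)) \<otimes> ?t f"
      using True by (simp add: gh s_def m_assoc)
    also have "\<dots> = (V1 [^] a \<otimes> V2 [^] b \<otimes> (V1 [^] (- c) \<otimes> V2 [^] (- d))) \<otimes> (T \<otimes> ?t f)"
      unfolding T' by (simp add: m_assoc)
    also have "T \<otimes> ?t f = ?t (\<not> f)" by (simp add: T)
    also have "(V1 [^] a \<otimes> V2 [^] b \<otimes> (V1 [^] (- c) \<otimes> V2 [^] (- d))) \<otimes> ?t (\<not> f) =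
        Z [^] (b * - c) \<otimes> s (a - c, b - d, \<not> f)"
      unfolding F by (simp add: s_def m_assoc)
    finally show ?thesis using True by (simp add: gh)
  qed
qed

text \<open>The map x |-> T x^-1 T is an anti-automorphism. It reverses both products in the
  commutation relation and sends Z to its inverse; the two effects cancel, so the images satisfy the
  same relation.\<close>

lemma involution_flip_comm:
  assumes cl [simp]: "V1 \<in> carrier G" "V2 \<in> carrier G" "T \<in> carrier G" "Z \<in> carrier G"
    and Z: "V1 \<otimes> Z = Z \<otimes> V1" "V2 \<otimes> Z = Z \<otimes> V2" "T \<otimes> Z = Z \<otimes> T"
    and comm: "V2 \<otimes> V1 = Z \<otimes> V1 \<otimes> V2" and T: "T \<otimes> T = \<one>"
  shows "(T \<otimes> inv V2 \<otimes> T) \<otimes> (T \<otimes> inv V1 \<otimes> T) = Z \<otimes> ((T \<otimes> inv V1 \<otimes> T) \<otimes> (T \<otimes> inv V2 \<otimes> T))"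
proof -
  have flip: "(T \<otimes> inv x \<otimes> T) \<otimes> (T \<otimes> inv y \<otimes> T) = T \<otimes> inv (y \<otimes> x) \<otimes> T"
    if [simp]: "x \<in> carrier G" "y \<in> carrier G" for x y
  proof -
    have "(T \<otimes> inv x \<otimes> T) \<otimes> (T \<otimes> inv y \<otimes> T) = T \<otimes> inv x \<otimes> (T \<otimes> T) \<otimes> inv y \<otimes> T"
      by (simp add: m_assoc)
    then show ?thesis by (simp add: T m_assoc inv_mult_group)
  qed
  have "V2 \<otimes> V1 = V1 \<otimes> V2 \<otimes> Z" using comm Z by (metis cl m_assoc)
  then have "inv (V2 \<otimes> V1) = inv Z \<otimes> inv (V1 \<otimes> V2)" by (simp add: inv_mult_group)
  then have "inv (V1 \<otimes> V2) = Z \<otimes> inv (V2 \<otimes> V1)" by (simp flip: m_assoc)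
  then have "T \<otimes> inv (V1 \<otimes> V2) \<otimes> T = (T \<otimes> Z) \<otimes> inv (V2 \<otimes> V1) \<otimes> T"
    by (simp add: m_assoc)
  then show ?thesis by (simp only: flip cl) (simp add: Z m_assoc)
qed

end

section \<open>The extension group and its kernel\<close>

locale action_cocycle =
  fixes \<theta> :: real and f :: "idx \<Rightarrow> idx \<Rightarrow> idx \<Rightarrow> complex"
  assumes cocycle: "act \<theta> g (f h l) - f (bidx g h) l + f g (bidx h l) - f g h = 0"
begin

lemma f_gone: "f gone g = f gone gone" "f g gone = act \<theta> g (f gone gone)"
  using cocycle[of gone gone g] cocycle[of g gone gone] by simp_all

text \<open>The extension of the index group by the additive group of functionals with factor set f.
  Since f is not assumed normalised, the unit carries the correction
  \<open>- f gone gone\<close>.\<close>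

definition E :: "((idx \<Rightarrow> complex) \<times> idx) monoid" where
  "E = \<lparr>carrier = UNIV, mult = (\<lambda>(m, g) (n, h). (m + act \<theta> g n + f g h, bidx g h)),
        one = (- f gone gone, gone)\<rparr>"

lemma E_simps [simp]:
  "carrier E = UNIV" "(m, g) \<otimes>\<^bsub>E\<^esub> (n, h) = (m + act \<theta> g n + f g h, bidx g h)"
  "\<one>\<^bsub>E\<^esub> = (- f gone gone, gone)"
  by (simp_all add: E_def)

lemma group_E: "group E"
proof (rule groupI)
  fix x y z assume "x \<in> carrier E" "y \<in> carrier E" "z \<in> carrier E"
  obtain m g n h k l where xyz: "x = (m, g)" "y = (n, h)" "z = (k, l)" by (metis surj_pair)
  show "x \<otimes>\<^bsub>E\<^esub> y \<otimes>\<^bsub>E\<^esub> z = x \<otimes>\<^bsub>E\<^esub> (y \<otimes>\<^bsub>E\<^esub> z)"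
    using cocycle[of g h l] by (simp add: xyz bidx_assoc act_linear act_act algebra_simps)
  show "\<one>\<^bsub>E\<^esub> \<otimes>\<^bsub>E\<^esub> x = x" by (simp add: xyz f_gone(1)[of g])
  have "(- f gone gone - act \<theta> (ginv g) m - f (ginv g) g, ginv g) \<otimes>\<^bsub>E\<^esub> x = \<one>\<^bsub>E\<^esub>"
    by (simp add: xyz)
  then show "\<exists>y\<in>carrier E. y \<otimes>\<^bsub>E\<^esub> x = \<one>\<^bsub>E\<^esub>" by (metis E_simps(1) UNIV_I)
qed simp_all

sublocale E: group E by (rule group_E)

text \<open>The embedding of the functionals as the kernel of \<open>snd\<close>. The shift by
  \<open>f gone gone\<close> makes it a homomorphism.\<close>

definition iota :: "(idx \<Rightarrow> complex) \<Rightarrow> (idx \<Rightarrow> complex) \<times> idx" where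
  "iota m = (m - f gone gone, gone)"

lemma iota_mult: "iota m \<otimes>\<^bsub>E\<^esub> (n, g) = (m + n, g)"
  by (simp add: iota_def f_gone(1)[of g])

lemma mult_iota: "(n, g) \<otimes>\<^bsub>E\<^esub> iota m = (n + act \<theta> g m, g)"
  by (simp add: iota_def f_gone(2)[of g] act_linear)

lemma iota_zero: "iota 0 = \<one>\<^bsub>E\<^esub>"
  by (simp add: iota_def)

lemma iota_add: "iota m \<otimes>\<^bsub>E\<^esub> iota n = iota (m + n)"
  using iota_mult[of m "n - f gone gone" gone] by (simp add: iota_def algebra_simps)

lemma iota_uminus: "inv\<^bsub>E\<^esub> (iota m) = iota (- m)"
  by (rule E.inv_equality) (simp_all add: iota_add iota_zero del: E_simps(3))

lemma iota_inject: "iota m \<otimes>\<^bsub>E\<^esub> x = iota n \<otimes>\<^bsub>E\<^esub> x \<longleftrightarrow> m = n"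
  by (cases x) (simp add: iota_mult)

lemma iota_commute: "x \<otimes>\<^bsub>E\<^esub> iota m = iota (act \<theta> (snd x) m) \<otimes>\<^bsub>E\<^esub> x"
  by (cases x) (simp add: iota_mult mult_iota add.commute)

text \<open>Multiples of the trace are invariant, hence central in the extension. They are thus
  admissible as Z in \<open>dihedral_section_mult\<close>.\<close>

lemma iota_delta0_commute: "x \<otimes>\<^bsub>E\<^esub> iota (delta0 c) = iota (delta0 c) \<otimes>\<^bsub>E\<^esub> x"
  by (simp add: iota_commute act_delta0)

lemma iota_delta0_pow: "iota (delta0 c) [^]\<^bsub>E\<^esub> (n::int) = iota (delta0 (of_int n * c))"
proof -
  have d: "delta0 a + delta0 b = delta0 (a + b)" "- delta0 a = delta0 (- a)" "delta0 0 = 0" for a b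
    by (auto simp: delta0_def fun_eq_iff)
  have nat: "iota (delta0 c) [^]\<^bsub>E\<^esub> (k::nat) = iota (delta0 (of_nat k * c))" for k
  proof (induction k)
    case 0
    show ?case by (simp only: of_nat_0 mult_zero_left d iota_zero nat_pow_0)
  qed (simp add: iota_add d algebra_simps)
  show ?thesis
    by (cases n rule: int_cases2)
       (simp_all add: E.int_pow_neg_int int_pow_int nat iota_uminus d)
qed

lemma snd_mult: "snd (x \<otimes>\<^bsub>E\<^esub> y) = bidx (snd x) (snd y)"
  by (cases x; cases y) simp

lemma snd_inv: "snd (inv\<^bsub>E\<^esub> x) = ginv (snd x)"
proof -
  have "bidx (snd (inv\<^bsub>E\<^esub> x)) (snd x) = gone"
    by (subst snd_mult[symmetric]) (simp add: E.l_inv)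
  then have "bidx (bidx (snd (inv\<^bsub>E\<^esub> x)) (snd x)) (ginv (snd x)) = ginv (snd x)" by simp
  then show ?thesis by (simp only: bidx_assoc bidx_ginv bidx_gone)
qed

lemma snd_pow: "snd V = (a, b, False) \<Longrightarrow> snd (V [^]\<^bsub>E\<^esub> (n::int)) = (n * a, n * b, False)"
proof -
  assume V: "snd V = (a, b, False)"
  have nat: "snd (V [^]\<^bsub>E\<^esub> (k::nat)) = (int k * a, int k * b, False)" for k
    by (induction k) (simp_all add: V snd_mult gone_def algebra_simps)
  show ?thesis
    by (cases n rule: int_cases2) (simp_all add: E.int_pow_neg_int int_pow_int nat snd_inv)
qed

section \<open>Lifts of t, U1 and U2\<close>

lemma involution_lift:
  obtains T where "snd T = gt" "T \<otimes>\<^bsub>E\<^esub> T = \<one>\<^bsub>E\<^esub>"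
proof
  have tt: "bidx gt gt = gone" by (simp add: gt_def gone_def)
  \<comment> \<open>The square of \<open>(m, gt)\<close> is the unit exactly if m + t.m = -r. The
    cocycle identity at (t, t, t) says that r is fixed by t, so m = -r/2 is a solution.\<close>
  define r where "r = f gt gt + f gone gone"
  have "act \<theta> gt r = r"
    using cocycle[of gt gt gt] by (simp add: tt f_gone(1)[of gt] f_gone(2)[of gt] r_def act_linear algebra_simps)
  then have "- half r + act \<theta> gt (- half r) = - (half r + half r)"
    by (simp add: act_linear half_simps(5))
  also have "\<dots> = - f gt gt - f gone gone" by (simp only: half_simps(1)) (simp add: r_def)
  finally have "- half r + act \<theta> gt (- half r) + f gt gt = - f gone gone" by simp
  then show "(- half r, gt) \<otimes>\<^bsub>E\<^esub> (- half r, gt) = \<one>\<^bsub>E\<^esub>" by (simp add: tt)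
qed simp

text \<open>The lifts of u form an affine space, and x |-> T x^-1 T is an affine involution of it, so the
midpoint of v and its image w is a fixed point.\<close>

lemma flip_midpoint:
  assumes T: "snd T = gt" "T \<otimes>\<^bsub>E\<^esub> T = \<one>\<^bsub>E\<^esub>" and u: "bidx (bidx gt (ginv u)) gt = u"
    and w: "T \<otimes>\<^bsub>E\<^esub> inv\<^bsub>E\<^esub> (v, u) \<otimes>\<^bsub>E\<^esub> T = (w, u)"
  shows "T \<otimes>\<^bsub>E\<^esub> (half (v + w), u) = inv\<^bsub>E\<^esub> (half (v + w), u) \<otimes>\<^bsub>E\<^esub> T"
proof -
  let ?\<sigma> = "\<lambda>x. T \<otimes>\<^bsub>E\<^esub> inv\<^bsub>E\<^esub> x \<otimes>\<^bsub>E\<^esub> T"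
  have invT: "inv\<^bsub>E\<^esub> T = T" by (rule E.inv_equality) (simp_all add: T del: E_simps(3))
  have TT: "T \<otimes>\<^bsub>E\<^esub> (T \<otimes>\<^bsub>E\<^esub> x) = x" for x
    using E.m_assoc[of T T x] T by (simp del: E_simps(3))
  have \<sigma>\<sigma>: "?\<sigma> (?\<sigma> x) = x" for x
    by (simp add: E.inv_mult_group E.m_assoc invT TT T del: E_simps(3))
  have \<sigma>iota: "?\<sigma> (iota m \<otimes>\<^bsub>E\<^esub> x) = iota (- act \<theta> (bidx gt (ginv (snd x))) m) \<otimes>\<^bsub>E\<^esub> ?\<sigma> x" for m x
  proof -
    have "?\<sigma> (iota m \<otimes>\<^bsub>E\<^esub> x) = (T \<otimes>\<^bsub>E\<^esub> inv\<^bsub>E\<^esub> x) \<otimes>\<^bsub>E\<^esub> iota (- m) \<otimes>\<^bsub>E\<^esub> T"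
      by (simp add: E.inv_mult_group iota_uminus E.m_assoc)
    also have "\<dots> = iota (- act \<theta> (bidx gt (ginv (snd x))) m) \<otimes>\<^bsub>E\<^esub> ?\<sigma> x"
      by (simp add: iota_commute[of "T \<otimes>\<^bsub>E\<^esub> inv\<^bsub>E\<^esub> x"] snd_mult snd_inv T act_linear E.m_assoc)
    finally show ?thesis .
  qed
  define n where "n = w - v"
  have \<sigma>V: "?\<sigma> (v, u) = iota n \<otimes>\<^bsub>E\<^esub> (v, u)" by (simp only: w) (simp add: iota_mult n_def)
  \<comment> \<open>By \<open>\<sigma>iota\<close>, the linear part of the flip on the lifts of u is
    minus the action of t u^-1. Applying the flip twice to \<open>(v, u)\<close> shows that this
    linear part negates n, so moving by n/2 from v gives a fixed point.\<close>
  let ?N = "act \<theta> (bidx gt (ginv u)) n"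
  have "iota 0 \<otimes>\<^bsub>E\<^esub> (v, u) = ?\<sigma> (iota n \<otimes>\<^bsub>E\<^esub> (v, u))"
    unfolding \<sigma>V[symmetric] \<sigma>\<sigma> by (simp add: iota_mult)
  also have "\<dots> = iota (- ?N) \<otimes>\<^bsub>E\<^esub> (iota n \<otimes>\<^bsub>E\<^esub> (v, u))" by (simp only: \<sigma>iota \<sigma>V snd_conv)
  also have "\<dots> = iota (- ?N + n) \<otimes>\<^bsub>E\<^esub> (v, u)" by (simp add: iota_mult)
  finally have N: "?N = n" unfolding iota_inject by (simp add: algebra_simps)
  let ?V = "(half (v + w), u)"
  have V: "?V = iota (half n) \<otimes>\<^bsub>E\<^esub> (v, u)"
    by (simp add: iota_mult n_def) (simp add: half_def fun_eq_iff field_simps)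
  have "?\<sigma> ?V = iota (- half n) \<otimes>\<^bsub>E\<^esub> (iota n \<otimes>\<^bsub>E\<^esub> (v, u))"
    unfolding V \<sigma>iota \<sigma>V by (simp add: half_simps N)
  also have "\<dots> = ?V"
    by (simp add: iota_mult n_def) (simp add: half_def fun_eq_iff field_simps)
  finally have "?\<sigma> ?V \<otimes>\<^bsub>E\<^esub> T = ?V \<otimes>\<^bsub>E\<^esub> T" by simp
  then have "T \<otimes>\<^bsub>E\<^esub> inv\<^bsub>E\<^esub> ?V = ?V \<otimes>\<^bsub>E\<^esub> T"
    by (simp add: E.m_assoc T del: E_simps(2,3))
  from E.intertwine_inv[OF _ _ _ this] show ?thesis by simp
qed

lemma cocycle_cohomologous:
  assumes irr: "\<theta> \<notin> \<rat>"
  obtains c s where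
    "\<And>g h. f g h = delta0 (of_int (bexp g h) * c) - (act \<theta> g (s h) - s (bidx g h) + s g)"
proof -
  obtain T where T: "snd T = gt" "T \<otimes>\<^bsub>E\<^esub> T = \<one>\<^bsub>E\<^esub>" by (rule involution_lift)
  \<comment> \<open>The contribution of the factor set to the difference of the two products of
    lifts of U1 and U2. Its value at the unit is the part that no choice of lifts removes.\<close>
  define r where "r = f gU2 gU1 - f gU1 gU2"
  define c where "c = r gone"
  obtain v1 v2 where v: "(v1 - act \<theta> gU2 v1) - (v2 - act \<theta> gU1 v2) = r - delta0 c"
    unfolding c_def by (rule solve_H2[OF irr])
  let ?Z = "iota (delta0 c)"
  have uu: "bidx gU2 gU1 = bidx gU1 gU2" by (simp add: gU1_def gU2_def)
  \<comment> \<open>For lifts of U2 and U1, having commutator Z is an affine condition on their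
    first components, so it survives averaging.\<close>
  have comm_iff: "(v2, gU2) \<otimes>\<^bsub>E\<^esub> (v1, gU1) = ?Z \<otimes>\<^bsub>E\<^esub> ((v1, gU1) \<otimes>\<^bsub>E\<^esub> (v2, gU2)) \<longleftrightarrow>
      (v1 - act \<theta> gU2 v1) - (v2 - act \<theta> gU1 v2) = r - delta0 c" for v1 v2
    by (simp add: iota_mult uu r_def) (auto simp: fun_eq_iff algebra_simps)
  have comm: "(v2, gU2) \<otimes>\<^bsub>E\<^esub> (v1, gU1) = ?Z \<otimes>\<^bsub>E\<^esub> ((v1, gU1) \<otimes>\<^bsub>E\<^esub> (v2, gU2))"
    unfolding comm_iff by (rule v)
  have u: "bidx (bidx gt (ginv gU1)) gt = gU1" "bidx (bidx gt (ginv gU2)) gt = gU2"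
    by (simp_all add: gt_def gU1_def gU2_def)
  obtain w1 where w1: "T \<otimes>\<^bsub>E\<^esub> inv\<^bsub>E\<^esub> (v1, gU1) \<otimes>\<^bsub>E\<^esub> T = (w1, gU1)"
    by (metis snd_mult snd_inv T(1) u(1) snd_conv surj_pair)
  obtain w2 where w2: "T \<otimes>\<^bsub>E\<^esub> inv\<^bsub>E\<^esub> (v2, gU2) \<otimes>\<^bsub>E\<^esub> T = (w2, gU2)"
    by (metis snd_mult snd_inv T(1) u(2) snd_conv surj_pair)
  \<comment> \<open>The flipped lifts have the same commutator, hence so do the midpoints, which in
    addition are inverted by T.\<close>
  have "(w2, gU2) \<otimes>\<^bsub>E\<^esub> (w1, gU1) = ?Z \<otimes>\<^bsub>E\<^esub> ((w1, gU1) \<otimes>\<^bsub>E\<^esub> (w2, gU2))"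
    unfolding w1[symmetric] w2[symmetric]
    by (rule E.involution_flip_comm)
       (use comm T in \<open>simp_all add: iota_delta0_commute E.m_assoc del: E_simps(2,3)\<close>)
  then have w: "(w1 - act \<theta> gU2 w1) - (w2 - act \<theta> gU1 w2) = r - delta0 c"
    unfolding comm_iff .
  define V1 V2 where "V1 = (half (v1 + w1), gU1)" and "V2 = (half (v2 + w2), gU2)"
  have "(half (v1 + w1) - act \<theta> gU2 (half (v1 + w1))) - (half (v2 + w2) - act \<theta> gU1 (half (v2 + w2)))
      = half (((v1 - act \<theta> gU2 v1) - (v2 - act \<theta> gU1 v2)) + ((w1 - act \<theta> gU2 w1) - (w2 - act \<theta> gU1 w2)))"
    by (simp add: half_simps act_linear)
  also have "\<dots> = r - delta0 c" unfolding v w by (simp only: half_simps(1,2))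
  finally have V: "V2 \<otimes>\<^bsub>E\<^esub> V1 = ?Z \<otimes>\<^bsub>E\<^esub> V1 \<otimes>\<^bsub>E\<^esub> V2"
    unfolding comm_iff[symmetric] V1_def V2_def by (simp add: E.m_assoc del: E_simps(2))
  \<comment> \<open>The normal form U1^a U2^b t^e evaluated at the lifts. It fails to be a
    homomorphism only by powers of the central Z, and comparing first components yields the formula
    for f.\<close>
  define S where "S = (\<lambda>(a::int, b::int, e). V1 [^]\<^bsub>E\<^esub> a \<otimes>\<^bsub>E\<^esub> V2 [^]\<^bsub>E\<^esub> b \<otimes>\<^bsub>E\<^esub> (if e then T else \<one>\<^bsub>E\<^esub>))"
  have S: "S g \<otimes>\<^bsub>E\<^esub> S h = ?Z [^]\<^bsub>E\<^esub> bexp g h \<otimes>\<^bsub>E\<^esub> S (bidx g h)" for g h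
    unfolding S_def
    by (rule E.dihedral_section_mult)
       (use V T flip_midpoint[OF T u(1) w1] flip_midpoint[OF T u(2) w2] in
         \<open>simp_all add: iota_delta0_commute V1_def V2_def del: E_simps(2,3)\<close>)
  have snd_S: "snd (S g) = g" for g
  proof -
    have "snd V1 = (1, 0, False)" "snd V2 = (0, 1, False)"
      by (simp_all add: V1_def V2_def gU1_def gU2_def)
    from snd_pow[OF this(1)] snd_pow[OF this(2)] show ?thesis
      by (cases g rule: idx_cases) (simp_all add: S_def snd_mult T gt_def gone_def)
  qed
  have S_eq: "S g = (fst (S g), g)" for g using snd_S[of g] by (metis prod.collapse)
  have "f g h = delta0 (of_int (bexp g h) * c) -
      (act \<theta> g (fst (S h)) - fst (S (bidx g h)) + fst (S g))" for g h
  proof -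
    have "(fst (S g), g) \<otimes>\<^bsub>E\<^esub> (fst (S h), h) =
        iota (delta0 (of_int (bexp g h) * c)) \<otimes>\<^bsub>E\<^esub> (fst (S (bidx g h)), bidx g h)"
      using S[of g h] unfolding S_eq[symmetric] iota_delta0_pow .
    then show ?thesis by (simp add: iota_mult algebra_simps)
  qed
  then show ?thesis by (rule that)
qed

end

section \<open>Hochschild cohomology\<close>

lemma act_eq_0_iff: "act \<theta> g m = 0 \<longleftrightarrow> m = 0"
  by (metis act_act act_gone act_zero bidx_ginv(1))

text \<open>A principal crossed homomorphism is subtracted to kill the values at U1 and U2, and with
  them those on Z^2. What remains is governed by the value at t and is made principal by
  halving.\<close>

lemma crossed_hom_principal:
  assumes irr: "\<theta> \<notin> \<rat>" and hom: "\<And>g h. c (bidx g h) = c g + act \<theta> g (c h)"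
  obtains m where "\<And>g. c g = act \<theta> g m - m"
proof -
  \<comment> \<open>The value at the unit is an ordinary homomorphism to the additive group of
    complex numbers.\<close>
  have chi: "c (bidx g h) gone = c g gone + c h gone" for g h
    by (simp add: hom act_at_gone)
  have "c gone gone = 0" using chi[of gone gone] by simp
  moreover have "bidx gt gt = gone" by (simp add: gt_def gone_def)
  ultimately have t0: "c gt gone = 0" using chi[of gt gt] by simp
  \<comment> \<open>From t u t = u^-1 this homomorphism takes equal values at u and u^-1; these
    values are also opposite, so they are 0.\<close>
  have z: "c u gone = 0" if "bidx (bidx gt u) gt = ginv u" for u
    using chi[of "bidx gt u" gt] chi[of gt u] chi[of u "ginv u"] that t0 \<open>c gone gone = 0\<close> by simp
  have z12: "c gU1 gone = 0" "c gU2 gone = 0"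
    by (rule z, simp add: gU1_def gU2_def gt_def)+
  have "bidx gU1 gU2 = bidx gU2 gU1" by (simp add: gU1_def gU2_def)
  then have "c gU1 - act \<theta> gU2 (c gU1) = c gU2 - act \<theta> gU1 (c gU2)"
    using hom[of gU1 gU2] hom[of gU2 gU1] by (simp add: algebra_simps)
  from solve_H1[OF irr this z12] obtain m
    where m: "m - act \<theta> gU1 m = c gU1" "m - act \<theta> gU2 m = c gU2" .
  define c' where "c' g = c g - (m - act \<theta> g m)" for g
  have hom': "c' (bidx g h) = c' g + act \<theta> g (c' h)" for g h
    by (simp add: c'_def hom act_linear act_act algebra_simps)
  have U: "c' gU1 = 0" "c' gU2 = 0" using m by (simp_all add: c'_def)
  \<comment> \<open>Vanishing of \<open>c'\<close> is preserved by left multiplication with U1 and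
    U2 in both directions, so it spreads from the unit to all of Z^2.\<close>
  define N where "N g \<longleftrightarrow> c' g = 0" for g
  have shift: "N (bidx u g) \<longleftrightarrow> N g" if "c' u = 0" for u g
    by (simp add: N_def hom' that act_eq_0_iff)
  have shift1: "N (a + 1, b, False) \<longleftrightarrow> N (a, b, False)" for a b
    using shift[OF U(1), of "(a, b, False)"] by (simp add: gU1_def add.commute)
  have shift2: "N (a, b + 1, False) \<longleftrightarrow> N (a, b, False)" for a b
    using shift[OF U(2), of "(a, b, False)"] by (simp add: gU2_def add.commute)
  have "N gone" using hom'[of gone gone] by (simp add: N_def)
  then have "N (0, 0, False)" by (simp add: gone_def)
  then have "N (a, 0, False)" for a
  proof (induction a rule: int_induct[of _ 0])
    case (step1 i) then show ?case by (simp add: shift1)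
  next
    case (step2 i) then show ?case using shift1[of "i - 1" 0] by simp
  qed
  then have "N (a, b, False)" for a b
  proof (induction b rule: int_induct[of _ 0])
    case (step1 i) then show ?case by (simp add: shift2)
  next
    case (step2 i) then show ?case using shift2[of a "i - 1"] by simp
  qed
  then have c'F: "c' (a, b, False) = 0" for a b by (simp add: N_def)
  \<comment> \<open>Writing a reflection as t times a translation shows that \<open>c'\<close> is
    constant on the t-coset; writing it as a translation times t shows that the constant n is fixed
    by translations. Since t^2 = 1, t negates n, so n/2 trivialises \<open>c'\<close>.\<close>
  define n where "n = c' gt"
  have nT: "c' (a, b, True) = n" for a b
    using hom'[of gt "(- a, - b, False)"] by (simp add: gt_def c'F n_def act_zero)
  have nF: "act \<theta> (a, b, False) n = n" for a b
    using hom'[of "(a, b, False)" gt] nT[of a b] by (simp add: gt_def c'F n_def)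
  have "n + act \<theta> gt n = 0"
    using hom'[of gt gt] c'F[of 0 0] by (simp add: gt_def n_def)
  then have nt: "act \<theta> gt n = - n" by (simp add: eq_neg_iff_add_eq_0 add.commute)
  have c'_eq: "c' g = half n - act \<theta> g (half n)" for g
  proof (cases g rule: idx_cases)
    case (1 a b)
    then show ?thesis by (simp add: half_simps nF c'F)
  next
    case (2 a b)
    have "g = bidx (a, b, False) gt" by (simp add: 2 gt_def)
    then have "act \<theta> g n = - n" by (simp add: nt act_linear nF flip: act_act)
    then show ?thesis using half_simps(1)[of n] by (simp add: half_simps(4,5) nT 2)
  qed
  have "c g = act \<theta> g (- (m + half n)) - (- (m + half n))" for g
    using c'_eq[of g] by (simp add: c'_def act_linear algebra_simps)
  then show ?thesis by (rule that)
qed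

section \<open>Hochschild coboundaries in group form\<close>

lemma lin_bmul_ubas:
  "lin L \<Longrightarrow> L (bmul \<theta> (ubas g) (ubas h)) = lam \<theta> powi bexp g h * L (ubas (bidx g h))"
  by (simp add: bmul_ubas linD bcoef_bexp)

lemma act_bidx: "act \<theta> g m (bidx g y) = lam \<theta> powi (bexp y g - bexp g y) * m (bidx y g)"
  by (simp add: act_def aexp_def)

lemma hcobound_0_ubas:
  assumes "\<phi> \<in> cochains 0" "\<And>k. \<phi> [] (ubas k) = m k"
  shows "hcobound \<theta> 0 \<phi> [ubas g] (ubas k) = lam \<theta> powi bexp g k * (act \<theta> g m - m) (bidx g k)"
proof -
  have "lin (\<phi> [])" using assms(1) by (simp add: cochains_0)
  note L = lin_bmul_ubas[OF this]
  show ?thesis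
    by (simp add: hcobound_0 L assms(2) act_bidx right_diff_distrib mult.assoc[symmetric] flip: powi_add)
qed

text \<open>Each term of the coboundary evaluates a product of u_g, u_h, u_k up to cyclic rotation.
  By \<open>bexp_cocycle\<close> the scalars agree with that of u_g u_h u_k, except in the rotated
  term, where the excess is the scalar in \<open>act\<close>.\<close>

lemma hcobound_1_ubas:
  assumes "\<phi> \<in> cochains (Suc 0)"
    "\<And>g k. \<phi> [ubas g] (ubas k) = lam \<theta> powi bexp g k * c g (bidx g k)"
  shows "hcobound \<theta> (Suc 0) \<phi> [ubas g, ubas h] (ubas k) =
    lam \<theta> powi (bexp g h + bexp (bidx g h) k) *
      (act \<theta> g (c h) - c (bidx g h) + c g) (bidx (bidx g h) k)"
proof -
  have l: "lin (\<phi> [x])" "lin (\<lambda>x. \<phi> [x] b)" for x b using assms(1) by (simp_all add: cochains_1)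
  note L = lin_bmul_ubas[OF l(1)] lin_bmul_ubas[OF l(2)]
  have 1: "bexp g h + bexp (bidx g h) k + (bexp (bidx h k) g - bexp g (bidx h k)) = bexp k g + bexp h (bidx k g)"
    using bexp_cocycle[of g h k] bexp_cocycle[of h k g] by simp
  have A: "act \<theta> g (c h) (bidx (bidx g h) k) =
      lam \<theta> powi (bexp (bidx h k) g - bexp g (bidx h k)) * c h (bidx h (bidx k g))"
    unfolding bidx_assoc act_bidx ..
  have "lam \<theta> powi (bexp g h + bexp (bidx g h) k) * act \<theta> g (c h) (bidx (bidx g h) k) =
      lam \<theta> powi (bexp k g + bexp h (bidx k g)) * c h (bidx h (bidx k g))"
    unfolding A mult.assoc[symmetric] powi_add[symmetric] 1 ..
  moreover have "lam \<theta> powi (bexp g h + bexp (bidx g h) k) * c g (bidx (bidx g h) k) =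
      lam \<theta> powi (bexp h k + bexp g (bidx h k)) * c g (bidx g (bidx h k))"
    by (simp add: bexp_cocycle bidx_assoc)
  ultimately show ?thesis
    by (simp add: hcobound_1 L assms(2) ring_distribs powi_add mult.assoc)
qed

lemma hcobound_2_ubas:
  assumes "\<phi> \<in> cochains 2"
    "\<And>g h k. \<phi> [ubas g, ubas h] (ubas k) =
       lam \<theta> powi (bexp g h + bexp (bidx g h) k) * f g h (bidx (bidx g h) k)"
  shows "hcobound \<theta> 2 \<phi> [ubas g, ubas h, ubas l] (ubas k) =
    lam \<theta> powi (bexp g h + bexp (bidx g h) l + bexp (bidx (bidx g h) l) k) *
      (act \<theta> g (f h l) - f (bidx g h) l + f g (bidx h l) - f g h) (bidx (bidx (bidx g h) l) k)"
proof -
  let ?P = "bexp g h + bexp (bidx g h) l + bexp (bidx (bidx g h) l) k"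
  let ?x = "bidx (bidx (bidx g h) l) k"
  have l: "lin (\<phi> [x, y])" "lin (\<lambda>x. \<phi> [x, y] b)" "lin (\<lambda>y. \<phi> [x, y] b)" for x y b
    using assms(1) by (simp_all add: cochains_2)
  note L = lin_bmul_ubas[OF l(1)] lin_bmul_ubas[OF l(2)] lin_bmul_ubas[OF l(3)]
  note coc = bexp_cocycle
  have A: "act \<theta> g (f h l) ?x =
      lam \<theta> powi (bexp (bidx (bidx h l) k) g - bexp g (bidx (bidx h l) k)) * f h l (bidx (bidx h l) (bidx k g))"
    using act_bidx[of \<theta> g "f h l" "bidx (bidx h l) k"] by (simp add: bidx_assoc)
  have 1: "?P + (bexp (bidx (bidx h l) k) g - bexp g (bidx (bidx h l) k)) =
      bexp k g + (bexp h l + bexp (bidx h l) (bidx k g))"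
    using coc[of "bidx h l" k g] coc[of g "bidx h l" k] coc[of g h l] by (simp add: bidx_assoc)
  have "lam \<theta> powi ?P * act \<theta> g (f h l) ?x =
      lam \<theta> powi (bexp k g + (bexp h l + bexp (bidx h l) (bidx k g))) * f h l (bidx (bidx h l) (bidx k g))"
    unfolding A mult.assoc[symmetric] powi_add[symmetric] 1 ..
  moreover have "lam \<theta> powi ?P * f g (bidx h l) ?x =
      lam \<theta> powi (bexp h l + (bexp g (bidx h l) + bexp (bidx g (bidx h l)) k)) *
        f g (bidx h l) (bidx (bidx g (bidx h l)) k)"
    using coc[of g h l] by (simp add: bidx_assoc add.assoc[symmetric])
  moreover have "lam \<theta> powi ?P * f g h ?x =
      lam \<theta> powi (bexp l k + (bexp g h + bexp (bidx g h) (bidx l k))) * f g h (bidx (bidx g h) (bidx l k))"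
    using coc[of "bidx g h" l k] by (simp add: bidx_assoc ac_simps)
  moreover have "lam \<theta> powi ?P * f (bidx g h) l ?x =
      lam \<theta> powi (bexp g h + (bexp (bidx g h) l + bexp (bidx (bidx g h) l) k)) * f (bidx g h) l ?x"
    by (simp add: ac_simps)
  ultimately show ?thesis
    by (simp add: hcobound_2 L assms(2) ring_distribs powi_add mult.assoc)
qed

section \<open>Degree 1\<close>

lemma H1_zero:
  assumes "\<theta> \<notin> \<rat>"
  shows "cocycles \<theta> 1 = coboundaries \<theta> 1"
proof (intro equalityI subsetI)
  fix \<phi> assume "\<phi> \<in> cocycles \<theta> 1"
  then have \<phi>: "\<phi> \<in> cochains (Suc 0)" "hcobound \<theta> (Suc 0) \<phi> = (\<lambda>_ _. 0)"
    by (simp_all add: cocycles_def)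
  \<comment> \<open>The substitution is inverted with x = g k, which is possible since the powers of
    lam are non-zero.\<close>
  define c where "c g x = \<phi> [ubas g] (ubas (bidx (ginv g) x)) / lam \<theta> powi bexp g (bidx (ginv g) x)" for g x
  have c: "\<phi> [ubas g] (ubas k) = lam \<theta> powi bexp g k * c g (bidx g k)" for g k
    by (simp add: c_def)
  have "(act \<theta> g (c h) - c (bidx g h) + c g) x = 0" for g h x
    using hcobound_1_ubas[OF \<phi>(1) c, of g h "bidx (ginv (bidx g h)) x"] by (simp add: \<phi>(2))
  then have "c (bidx g h) x = (c g + act \<theta> g (c h)) x" for g h x
    by (simp add: algebra_simps)
  then have "c (bidx g h) = c g + act \<theta> g (c h)" for g h by blast
  from crossed_hom_principal[OF assms this] obtain m where m: "\<And>g. c g = act \<theta> g m - m" by blast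
  have "hcobound \<theta> 0 (ext0 m) = \<phi>"
    by (rule cochain_eqI_1[OF hcobound_0_cochain[OF ext_cochains(1)] \<phi>(1)])
       (simp only: hcobound_0_ubas[OF ext_cochains(1) ext_ubas(1)] c m)
  then show "\<phi> \<in> coboundaries \<theta> 1"
    using ext_cochains(1)[of m] by (auto simp: coboundaries_def)
next
  fix \<phi> assume "\<phi> \<in> coboundaries \<theta> 1"
  then obtain \<psi> where \<psi>: "\<psi> \<in> cochains 0" "\<phi> = hcobound \<theta> 0 \<psi>" by (auto simp: coboundaries_def)
  define m where "m k = \<psi> [] (ubas k)" for k
  have "hcobound \<theta> 0 \<psi> [ubas g] (ubas k) = lam \<theta> powi bexp g k * (act \<theta> g m - m) (bidx g k)" for g k
    by (rule hcobound_0_ubas) (simp_all add: \<psi> m_def)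
  note 1 = hcobound_1_ubas[OF hcobound_0_cochain[OF \<psi>(1)] this]
  have "hcobound \<theta> (Suc 0) \<phi> = (\<lambda>_ _. 0)"
    unfolding \<psi>(2)
    by (rule hcobound_1_eq_zeroI[OF hcobound_0_cochain[OF \<psi>(1)]], unfold 1)
       (simp add: act_linear act_act)
  then show "\<phi> \<in> cocycles \<theta> 1"
    using hcobound_0_cochain[OF \<psi>(1)] by (simp add: cocycles_def \<psi>(2))
qed

lemma lin_sum_scaled:
  "(\<And>i. i \<in> A \<Longrightarrow> lin (L i)) \<Longrightarrow> lin (\<lambda>b. \<Sum>i\<in>A. c i * L i b)"
  by (simp add: lin_def sum.distrib sum_distrib_left distrib_left mult.left_commute)

lemma cochains_0_diff_lincomb:
  assumes "z \<in> cochains 0" "set \<phi>s \<subseteq> cochains 0"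
  shows "(\<lambda>ys b. z ys b - lincomb c \<phi>s ys b) \<in> cochains 0"
proof -
  have \<phi>: "\<phi>s ! i \<in> cochains 0" if "i < length \<phi>s" for i using assms(2) that by auto
  have "lin (\<lambda>b. \<Sum>i<length \<phi>s. c i * (\<phi>s ! i) [] b)"
    by (rule lin_sum_scaled) (use \<phi> in \<open>simp add: cochains_0\<close>)
  then show ?thesis using assms(1) \<phi> by (simp add: cochains_0 lincomb_def lin_comb(3))
qed

section \<open>Degree 2\<close>

lemma H2_dim:
  assumes irr: "\<theta> \<notin> \<rat>"
  shows "hh_dim \<theta> 2 1"
proof -
  \<comment> \<open>Up to the factor 2 pi i, this is the trace of the theta-derivative of the
    product u_g u_h multiplied by u_k.\<close>
  define \<Phi> where "\<Phi> = ext2 (\<lambda>g h k. lam \<theta> powi (bexp g h + bexp (bidx g h) k) *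
    delta0 (of_int (bexp g h)) (bidx (bidx g h) k))"
  have \<Phi>: "\<Phi> \<in> cochains 2" by (simp add: \<Phi>_def ext_cochains)
  have \<Phi>_ubas: "\<Phi> [ubas g, ubas h] (ubas k) = lam \<theta> powi (bexp g h + bexp (bidx g h) k) *
      delta0 (of_int (bexp g h)) (bidx (bidx g h) k)" for g h k
    by (simp add: \<Phi>_def)
  have "hcobound \<theta> 2 \<Phi> = (\<lambda>_ _. 0)"
  proof (rule hcobound_2_eq_zeroI[OF \<Phi>], unfold hcobound_2_ubas[OF \<Phi> \<Phi>_ubas])
    fix g h l k
    have "of_int (bexp h l) - of_int (bexp (bidx g h) l) + of_int (bexp g (bidx h l)) -
        of_int (bexp g h) = (0::complex)"
      using bexp_cocycle[of g h l] by (simp flip: of_int_add of_int_diff)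
    then have "act \<theta> g (delta0 (of_int (bexp h l))) - delta0 (of_int (bexp (bidx g h) l)) +
        delta0 (of_int (bexp g (bidx h l))) - delta0 (of_int (bexp g h)) = 0"
      unfolding act_delta0 by (intro HOL.ext) (simp add: delta0_def)
    then show "lam \<theta> powi (bexp g h + bexp (bidx g h) l + bexp (bidx (bidx g h) l) k) *
       (act \<theta> g (delta0 (of_int (bexp h l))) - delta0 (of_int (bexp (bidx g h) l)) +
        delta0 (of_int (bexp g (bidx h l))) - delta0 (of_int (bexp g h)))
        (bidx (bidx (bidx g h) l) k) = 0" by simp
  qed
  then have cocyc: "\<Phi> \<in> cocycles \<theta> 2" using \<Phi> by (simp add: cocycles_def)
  have lc: "lincomb c [\<Phi>] = (\<lambda>ys b. c 0 * \<Phi> ys b)" for c by (simp add: lincomb_def)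
  have indep: "c 0 = 0" if lin: "lincomb c [\<Phi>] \<in> coboundaries \<theta> 2" for c
  proof -
    from lin obtain \<psi> where \<psi>: "\<psi> \<in> cochains (Suc 0)" "hcobound \<theta> (Suc 0) \<psi> = (\<lambda>ys b. c 0 * \<Phi> ys b)"
      by (auto simp: coboundaries_def lc)
    define s where "s g x = \<psi> [ubas g] (ubas (bidx (ginv g) x)) / lam \<theta> powi bexp g (bidx (ginv g) x)" for g x
    have s: "\<psi> [ubas g] (ubas k) = lam \<theta> powi bexp g k * s g (bidx g k)" for g k
      by (simp add: s_def)
    \<comment> \<open>Taking k inverse to g h evaluates the equation at the unit, where the action
      is trivial.\<close>
    have e: "c 0 * of_int (bexp g h) = s h gone - s (bidx g h) gone + s g gone" for g h
      using hcobound_1_ubas[OF \<psi>(1) s, of g h "ginv (bidx g h)"]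
      by (simp add: \<psi>(2) \<Phi>_ubas act_at_gone delta0_def)
    \<comment> \<open>The right-hand side of \<open>e\<close> is therefore symmetric in U1 and U2,
      whereas \<open>bexp\<close> takes the values 1 and 0 on the two orders.\<close>
    have "bidx gU2 gU1 = bidx gU1 gU2" by (simp add: gU1_def gU2_def)
    then have "c 0 * of_int (bexp gU2 gU1) = c 0 * of_int (bexp gU1 gU2)"
      unfolding e by simp
    then show "c 0 = 0" by (simp add: gU1_def gU2_def)
  qed
  have span: "\<exists>c. (\<lambda>ys b. z ys b - lincomb c [\<Phi>] ys b) \<in> coboundaries \<theta> 2" if "z \<in> cocycles \<theta> 2" for z
  proof -
    from that have z: "z \<in> cochains 2" "hcobound \<theta> 2 z = (\<lambda>_ _. 0)" by (simp_all add: cocycles_def)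
    define f where "f g h x = z [ubas g, ubas h] (ubas (bidx (ginv (bidx g h)) x)) /
        lam \<theta> powi (bexp g h + bexp (bidx g h) (bidx (ginv (bidx g h)) x))" for g h x
    have f: "z [ubas g, ubas h] (ubas k) =
        lam \<theta> powi (bexp g h + bexp (bidx g h) k) * f g h (bidx (bidx g h) k)" for g h k
      by (simp add: f_def)
    have "(act \<theta> g (f h l) - f (bidx g h) l + f g (bidx h l) - f g h) x = 0" for g h l x
      using hcobound_2_ubas[OF z(1) f, of g h l "bidx (ginv (bidx (bidx g h) l)) x"] by (simp add: z(2))
    then have "action_cocycle \<theta> f" by unfold_locales (intro HOL.ext, simp)
    then obtain c s where cs: "\<And>g h. f g h = delta0 (of_int (bexp g h) * c) -
        (act \<theta> g (s h) - s (bidx g h) + s g)"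
      using action_cocycle.cocycle_cohomologous[OF _ irr] by blast
    \<comment> \<open>The minus sign is needed because \<open>cs\<close> expresses f as a multiple
      of the generator minus a coboundary.\<close>
    define \<psi> where "\<psi> = ext1 (\<lambda>g k. lam \<theta> powi bexp g k * (- s g) (bidx g k))"
    have \<psi>: "\<psi> \<in> cochains (Suc 0)" by (simp add: \<psi>_def ext_cochains)
    have \<psi>_ubas: "\<psi> [ubas g] (ubas k) = lam \<theta> powi bexp g k * (- s g) (bidx g k)" for g k
      by (simp add: \<psi>_def)
    have "(\<lambda>ys b. z ys b - lincomb (\<lambda>_. c) [\<Phi>] ys b) = hcobound \<theta> (Suc 0) \<psi>"
    proof (rule cochain_eqI_2)
      show "(\<lambda>ys b. z ys b - lincomb (\<lambda>_. c) [\<Phi>] ys b) \<in> cochains 2"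
        using z(1) \<Phi> by (simp add: lc cochains_2 lin_comb(3,4))
      show "hcobound \<theta> (Suc 0) \<psi> \<in> cochains 2" by (rule hcobound_1_cochain[OF \<psi>])
      fix g h k
      have "delta0 (of_int (bexp g h) * c) x = c * delta0 (of_int (bexp g h)) x" for x
        by (simp add: delta0_def)
      then show "z [ubas g, ubas h] (ubas k) - lincomb (\<lambda>_. c) [\<Phi>] [ubas g, ubas h] (ubas k) =
          hcobound \<theta> (Suc 0) \<psi> [ubas g, ubas h] (ubas k)"
        unfolding lc f hcobound_1_ubas[OF \<psi> \<psi>_ubas] \<Phi>_ubas cs
        by (simp add: act_linear ring_distribs)
    qed
    then show ?thesis using \<psi> by (auto simp: coboundaries_def)
  qed
  show ?thesis
    unfolding hh_dim_def
    using cocyc indep span by (intro exI[of _ "[\<Phi>]"]) auto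
qed

section \<open>Degree 0\<close>

lemma act_translation:
  "act \<theta> (a, b, False) m (p, q, False) = lam \<theta> powi (q * a - b * p) * m (p, q, False)"
  "act \<theta> (a, b, False) m (p, q, True) =
     lam \<theta> powi (2 * a * b - q * a - b * p) * m (p - 2 * a, q - 2 * b, True)"
  by (simp_all add: act_def aexp_def algebra_simps)

text \<open>The reflections fall into four conjugacy classes, given by the parities of p and q. Each
  carries one invariant functional, with \<open>tw\<close> supplying the phase.\<close>

definition ttrace :: "real \<Rightarrow> int \<Rightarrow> int \<Rightarrow> idx \<Rightarrow> complex" where
  "ttrace \<theta> i j = (\<lambda>(p, q, e). if e \<and> p mod 2 = i \<and> q mod 2 = j then tw \<theta> p q else 0)"

lemma act_ttrace: "act \<theta> g (ttrace \<theta> i j) = ttrace \<theta> i j"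
proof -
  let ?m = "ttrace \<theta> i j"
  have tw: "lam \<theta> powi (2 * a * b - q * a - b * p) * tw \<theta> (p - 2 * a) (q - 2 * b) = tw \<theta> p q" for a b p q
  proof -
    have l: "lam \<theta> powi n = cis (pi * \<theta>) powi (2 * n)" for n
      by (simp add: lam_def cis_power_int algebra_simps)
    show ?thesis by (simp add: l tw_def power_int_add[symmetric] algebra_simps)
  qed
  have mod2: "(p - 2 * a) mod 2 = p mod 2" for p a :: int by presburger
  have F: "act \<theta> (a, b, False) ?m = ?m" for a b
  proof
    fix x show "act \<theta> (a, b, False) ?m x = ?m x"
      using tw mod2 by (cases x rule: idx_cases) (simp_all add: act_translation ttrace_def)
  qed
  have t: "act \<theta> gt ?m = ?m"
  proof
    fix x :: idx
    obtain p q e where x: "x = (p, q, e)" by (metis prod_cases3)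
    have "(- p) mod 2 = p mod 2" for p :: int by presburger
    then show "act \<theta> gt ?m x = ?m x" by (simp add: x act_t ttrace_def tw_def)
  qed
  show ?thesis
  proof (cases g rule: idx_cases)
    case (2 a b)
    then have "g = bidx (a, b, False) gt" by (simp add: gt_def)
    then show ?thesis by (simp add: F t flip: act_act)
  qed (simp add: F)
qed

lemma H0_dim:
  assumes irr: "\<theta> \<notin> \<rat>"
  shows "hh_dim \<theta> 0 5"
proof -
  define ms where "ms = [delta0 1, ttrace \<theta> 0 0, ttrace \<theta> 0 1, ttrace \<theta> 1 0, ttrace \<theta> 1 1]"
  define \<phi>s where "\<phi>s = map ext0 ms"
  have coch: "set \<phi>s \<subseteq> cochains 0" by (auto simp: \<phi>s_def ext_cochains)
  have inv: "act \<theta> g m = m" if "m \<in> set ms" for g m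
    using that by (auto simp: ms_def act_delta0 act_ttrace)
  have cocyc: "set \<phi>s \<subseteq> cocycles \<theta> 0"
  proof
    fix \<phi> assume "\<phi> \<in> set \<phi>s"
    then obtain m where m: "m \<in> set ms" "\<phi> = ext0 m" by (auto simp: \<phi>s_def)
    have "hcobound \<theta> 0 (ext0 m) = (\<lambda>_ _. 0)"
      by (rule hcobound_0_eq_zeroI[OF ext_cochains(1)])
         (simp add: hcobound_0_ubas[OF ext_cochains(1) ext_ubas(1)] inv[OF m(1)])
    then show "\<phi> \<in> cocycles \<theta> 0" by (simp add: m cocycles_def ext_cochains)
  qed
  have len: "length \<phi>s = 5" by (simp add: \<phi>s_def ms_def)
  have lc: "lincomb c \<phi>s [] (ubas x) = c 0 * delta0 1 x + c 1 * ttrace \<theta> 0 0 x + c 2 * ttrace \<theta> 0 1 x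
      + c 3 * ttrace \<theta> 1 0 x + c 4 * ttrace \<theta> 1 1 x" for c x
  proof -
    have "{..<5::nat} = {0, 1, 2, 3, 4}" by auto
    then have "lincomb c \<phi>s [] (ubas x) = (\<Sum>i\<in>{0, 1, 2, 3, 4}. c i * (\<phi>s ! i) [] (ubas x))"
      unfolding lincomb_def len by simp
    then show ?thesis by (simp add: \<phi>s_def ms_def add.assoc)
  qed
  have indep: "c i = 0" if lin: "lincomb c \<phi>s \<in> coboundaries \<theta> 0" and "i < 5" for c i
  proof -
    have z: "lincomb c \<phi>s [] (ubas x) = 0" for x using lin by (simp add: coboundaries_def)
    \<comment> \<open>At each of the five test indices exactly one of the five functionals is
      non-zero.\<close>
    have "c 0 = 0" "c 1 = 0" "c 2 = 0" "c 3 = 0" "c 4 = 0"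
      using z[of gone] z[of "(0, 0, True)"] z[of "(0, 1, True)"] z[of "(1, 0, True)"] z[of "(1, 1, True)"]
      unfolding lc by (simp_all add: delta0_def ttrace_def gone_def)
    moreover have "i \<in> {0, 1, 2, 3, 4}" using \<open>i < 5\<close> by auto
    ultimately show ?thesis by auto
  qed
  have span: "\<exists>c. (\<lambda>ys b. z ys b - lincomb c \<phi>s ys b) \<in> coboundaries \<theta> 0" if "z \<in> cocycles \<theta> 0" for z
  proof -
    from that have z: "z \<in> cochains 0" "hcobound \<theta> 0 z = (\<lambda>_ _. 0)" by (simp_all add: cocycles_def)
    define m where "m k = z [] (ubas k)" for k
    have "act \<theta> g m x = m x" for g x
      using hcobound_0_ubas[OF z(1) m_def[symmetric], of \<theta> g "bidx (ginv g) x"] by (simp add: z(2))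
    then have inv: "act \<theta> g m = m" for g by blast
    \<comment> \<open>Invariance under U1 and U2 forces the value at a non-trivial character to
      vanish.\<close>
    have F: "m (p, q, False) = 0" if "(p, q) \<noteq> (0, 0)" for p q
      using act_U(1,2)[of \<theta> m p q] lam_powi_eq_1[OF irr, of q] lam_powi_eq_1[OF irr, of "- p"] that
      unfolding inv by auto
    let ?r = "\<lambda>p q. m (p, q, True) / tw \<theta> p q"
    have per: "?r p q = ?r (p - 2) q" "?r p q = ?r p (q - 2)" for p q
      using tw_act_U[of \<theta> m p q] unfolding inv .
    have r: "?r p q = ?r (p mod 2) (q mod 2)" for p q
      using shift2_periodic[of "\<lambda>p. ?r p q" p, OF per(1)]
        shift2_periodic[of "\<lambda>q. ?r (p mod 2) q" q, OF per(2)] by simp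
    have T: "m (p, q, True) = ?r (p mod 2) (q mod 2) * tw \<theta> p q" for p q
      using r[of p q] by (simp add: field_simps)
    \<comment> \<open>The coefficients are the value at the unit and the untwisted values at the
      four parity classes, in the order of \<open>ms\<close>.\<close>
    define c where "c i = [m gone, ?r 0 0, ?r 0 1, ?r 1 0, ?r 1 1] ! i" for i
    have "(\<lambda>ys b. z ys b - lincomb c \<phi>s ys b) = (\<lambda>_ _. 0)"
    proof (rule cochain_eqI_0)
      show "(\<lambda>ys b. z ys b - lincomb c \<phi>s ys b) \<in> cochains 0"
        by (rule cochains_0_diff_lincomb[OF z(1) coch])
      show "(\<lambda>_ _. 0) \<in> cochains 0" by (simp add: cochains_0 lin_comb(1))
      fix x
      have "m x = lincomb c \<phi>s [] (ubas x)"
      proof (cases x rule: idx_cases)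
        case (1 p q)
        then show ?thesis using F[of p q]
          by (auto simp: lc delta0_def ttrace_def c_def gone_def)
      next
        case (2 p q)
        have "p mod 2 = 0 \<or> p mod 2 = 1" "q mod 2 = 0 \<or> q mod 2 = 1" by presburger+
        then show ?thesis
          unfolding 2 lc by (subst T) (auto simp: delta0_def ttrace_def c_def gone_def)
      qed
      then show "z [] (ubas x) - lincomb c \<phi>s [] (ubas x) = 0" by (simp add: m_def)
    qed
    then show ?thesis by (auto simp: coboundaries_def intro!: exI[of _ c])
  qed
  show ?thesis
    unfolding hh_dim_def using len cocyc indep span by (intro exI[of _ \<phi>s]) simp
qed

theorem theorem1:
  fixes \<theta> :: real
  assumes "\<theta> \<notin> \<rat>"
  shows "hh_dim \<theta> 0 5 \<and> cocycles \<theta> 1 = coboundaries \<theta> 1 \<and> hh_dim \<theta> 2 1"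
  using H0_dim[OF assms] H1_zero[OF assms] H2_dim[OF assms] by blast

end
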